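(* The Banach algebra $L(\ell_\infty)$ of bounded linear operators on $\ell_\infty$ has a continuum of distinct closed ideals; that is, there is a family of cardinality $2^{\aleph_0}$ of pairwise distinct closed ideals in $L(\ell_\infty)$.
   Context: $\ell_\infty$ is the Banach space of bounded scalar sequences (real or complex scalars) with the supremum norm. "Ideal" always means two-sided ideal, and closed means closed in the operator norm. *)

theory Defs
  imports
    "HOL-Analysis.Analysis"
    "HOL-Algebra.Ideal"
    "HOL-Library.Equipollence"
begin

text \<open>
  Since \<^typ>\<open>nat\<close> carries the discrete topology, every sequence is continuous, so the bounded
  continuous functions on \<^typ>\<open>nat\<close> are exactly the bounded sequences, and their norm is the
  supremum norm. The scalar field is kept generic so that the real and complex
  spaces can be treated together.
\<close>

type_synonym 'k linfty = "nat \<Rightarrow>\<^sub>C 'k"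

definition scale_linfty :: "'k::real_normed_field \<Rightarrow> 'k linfty \<Rightarrow> 'k linfty" where
  "scale_linfty c x = Bcontfun (\<lambda>n. c * apply_bcontfun x n)"

lemma apply_scale_linfty [simp]: "apply_bcontfun (scale_linfty c x) n = c * apply_bcontfun x n"
proof -
  have "bounded ((\<lambda>y. c * y) ` range (apply_bcontfun x))"
    by (intro bounded_linear_image bounded_linear_mult_right) simp
  then have "(\<lambda>n. c * apply_bcontfun x n) \<in> bcontfun"
    by (simp add: bcontfun_def image_image)
  then show ?thesis
    by (simp add: scale_linfty_def Bcontfun_inverse)
qed

text \<open>
  The library type of bounded linear operators is only real-linear, so linearity over the scalar
  field is imposed separately; for real scalars the extra condition always holds. The norm on this
  type is the operator norm, and the topology used by \<^const>\<open>closed\<close> is the one it induces.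
\<close>

type_synonym 'k linfty_op = "'k linfty \<Rightarrow>\<^sub>L 'k linfty"

definition L_linfty_carrier :: "'k::real_normed_field linfty_op set" where
  "L_linfty_carrier =
     {T. \<forall>c x. blinfun_apply T (scale_linfty c x) = scale_linfty c (blinfun_apply T x)}"

definition L_linfty :: "'k::real_normed_field linfty_op ring" where
  "L_linfty =
     \<lparr>carrier = L_linfty_carrier, mult = (o\<^sub>L), one = id_blinfun, zero = 0, add = (+)\<rparr>"

lemma scale_linfty_add: "scale_linfty c (x + y) = scale_linfty c x + scale_linfty c y"
  by (rule bcontfun_eqI) (simp add: algebra_simps)

lemma scale_linfty_minus: "scale_linfty c (- x) = - scale_linfty c x"
  by (rule bcontfun_eqI) simp

lemma scale_linfty_zero: "scale_linfty c 0 = 0"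
  by (rule bcontfun_eqI) simp

lemma scale_linfty_real: "scale_linfty c x = c *\<^sub>R x"
  by (rule bcontfun_eqI) simp

lemma L_linfty_carrier_real: "(L_linfty_carrier :: real linfty_op set) = UNIV"
  by (auto simp: L_linfty_carrier_def scale_linfty_real blinfun.scaleR_right)

lemma ring_L_linfty: "ring (L_linfty :: 'k::real_normed_field linfty_op ring)"
proof (rule ringI)
  show "abelian_group (L_linfty :: 'k linfty_op ring)"
  proof (rule abelian_groupI)
    fix T :: "'k linfty_op"
    assume "T \<in> carrier L_linfty"
    then show "\<exists>S\<in>carrier L_linfty. S \<oplus>\<^bsub>L_linfty\<^esub> T = \<zero>\<^bsub>L_linfty\<^esub>"
      by (intro bexI[of _ "- T"])
        (auto simp: L_linfty_def L_linfty_carrier_def blinfun.minus_left scale_linfty_minus)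
  qed (auto simp: L_linfty_def L_linfty_carrier_def blinfun.add_left blinfun.zero_left
      scale_linfty_add scale_linfty_zero)
  show "Group.monoid (L_linfty :: 'k linfty_op ring)"
    by (rule monoidI) (auto simp: L_linfty_def L_linfty_carrier_def blinfun_eqI)
qed (auto simp: L_linfty_def blinfun.add_left blinfun.add_right intro!: blinfun_eqI)

text \<open>
  Because \<^const>\<open>L_linfty\<close> contains all scalar multiples of the identity, every two-sided ring ideal
  is automatically a linear subspace, so ring ideals and algebra ideals coincide
  (see \<open>ideal_L_linfty_scale\<close>).
\<close>

definition closed_ideals :: "'k::real_normed_field linfty_op set set" where
  "closed_ideals = {I. ideal I L_linfty \<and> closed I}"

definition scale_op :: "'k::real_normed_field \<Rightarrow> 'k linfty_op" where
  "scale_op c = Blinfun (scale_linfty c)"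

lemma apply_scale_op [simp]: "blinfun_apply (scale_op c) x = scale_linfty c x"
proof -
  have "bounded_linear (scale_linfty c)"
  proof (rule bounded_linear_intro[where K = "norm c"])
    fix x y :: "'a linfty" and r :: real
    show "scale_linfty c (x + y) = scale_linfty c x + scale_linfty c y"
      by (rule scale_linfty_add)
    show "scale_linfty c (r *\<^sub>R x) = r *\<^sub>R scale_linfty c x"
      by (rule bcontfun_eqI) simp
    show "norm (scale_linfty c x) \<le> norm x * norm c"
    proof (rule norm_bound)
      fix n
      show "norm (apply_bcontfun (scale_linfty c x) n) \<le> norm x * norm c"
        using mult_right_mono[OF norm_bounded[of x n] norm_ge_zero[of c]]
        by (simp add: norm_mult mult.commute)
    qed
  qed
  then show ?thesis
    by (simp add: scale_op_def bounded_linear_Blinfun_apply)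
qed

lemma ideal_L_linfty_scale:
  assumes "ideal I L_linfty" and "T \<in> I"
  shows "scale_op c o\<^sub>L T \<in> I"
proof -
  have "scale_op c \<in> carrier L_linfty"
    unfolding L_linfty_def L_linfty_carrier_def
    by (auto intro!: bcontfun_eqI simp: mult.left_commute)
  then show ?thesis
    using ideal.I_l_closed[OF assms] by (simp add: L_linfty_def)
qed

end

theory Submission
  imports Defs
begin

text \<open>
  The closed ideals are told apart by operators that send a bounded sequence to some of its
  Walsh coefficients. Finite sets of natural numbers are coded by natural numbers, so a bounded
  sequence is a function on the group of finite sets with symmetric difference. This group carries a
  finitely additive invariant mean and the Walsh functions \<open>walsh B\<close> as characters. Fix sets
  \<open>A 0, A 1, \<dots>\<close> and cut the index set into consecutive blocks. For a set \<open>S\<close> of block numbers,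
  \<open>block_op S\<close> maps \<open>x\<close> to the sequence of the coefficients \<open>mean (x * walsh (A k))\<close>, set to zero when the
  block of \<open>k\<close> has a number outside \<open>S\<close>.

  Block \<open>n\<close> has \<open>N\<close> Walsh functions, which depend only on the trace of their argument on a finite
  interval and thus form a sign matrix with \<open>M\<close> points and \<open>N\<close> functions. An operator is called small at
  \<open>n\<close> (\<open>diagonal_small\<close>) if, after discarding a small proportion of the points, it cannot
  be made to correlate with this matrix by any choice of input vectors and output functionals.
  Being small at \<open>n\<close>, for \<open>n \<rightarrow> \<infinity>\<close> outside \<open>S\<close>, is stable under sums, under composition with bounded
  operators and under norm limits. The operators with this property therefore form a closed ideal
  \<open>block_ideal S\<close>.

  Two facts separate these ideals. If \<open>n \<in> S\<close>, then \<open>block_op S\<close> contains the matrix of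
  block \<open>n\<close> and is not small there (\<open>not_small_block_op\<close>). If \<open>n \<notin> S\<close>, it is small at \<open>n\<close>, with an error
  that tends to zero (\<open>small_block_op\<close>). The blocks before \<open>n\<close> have too few indices altogether. The blocks after \<open>n\<close>
  are so independent that they satisfy Khintchine's inequality with a large exponent
  \<open>2p\<close> (\<open>mean_even_power_le\<close>). Correlating them with the matrix of block \<open>n\<close> produces a maximum of
  \<open>M\<close> random sums of variance about \<open>N\<close>. This maximum has size about \<open>M ^ (1 / 2p) * sqrt N\<close>, which is
  negligible against the required \<open>N\<close> because \<open>M\<close> is much smaller than \<open>N ^ p\<close>. A greedy choice
  yields blocks with \<open>d\<close>-fold independence on about \<open>N ^ d\<close> points, so it suffices that \<open>d\<close>
  grows geometrically from block to block (\<open>ex_independent_blocks\<close>).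

  Hence \<open>block_ideal S\<close> and \<open>block_ideal S'\<close> differ as soon as \<open>S - S'\<close> is infinite, and an almost
  disjoint family of sets of block numbers indexed by all sets of natural numbers gives the
  continuum. The construction is carried out over the reals and transferred to the scalar field
  through its real components.
\<close>

section \<open>Generalized limits along an ultrafilter\<close>

text \<open>
  Filters are ordered by \<open>\<le>\<close> as "finer", so an ultrafilter is a minimal proper filter. Zorn's lemma
  applies because the infimum of a chain of proper filters is proper: an event is eventually true for
  the infimum only if it is so for a member of the chain.
\<close>

lemma ultrafilter_below:
  fixes F :: "'a filter"
  assumes "F \<noteq> bot"
  obtains U where "U \<le> F" "U \<noteq> bot" "\<And>P. eventually P U \<or> eventually (\<lambda>x. \<not> P x) U"
proof -
  define D where "D = {G. G \<le> F \<and> G \<noteq> bot}"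
  have "\<exists>U\<in>D. \<forall>G\<in>D. G \<le> U \<longrightarrow> G = U"
  proof (rule predicate_Zorn[where P = "\<lambda>G H. H \<le> G"])
    show "partial_order_on D (relation_of (\<lambda>G H. H \<le> G) D)"
      by (auto simp: partial_order_on_def preorder_on_def refl_on_def trans_def antisym_def
          relation_of_def)
  next
    fix C assume C: "C \<in> Chains (relation_of (\<lambda>G H. H \<le> G) D)"
    show "\<exists>u\<in>D. \<forall>G\<in>C. u \<le> G"
    proof (cases "C = {}")
      case True
      then show ?thesis using assms by (auto simp: D_def)
    next
      case False
      have CD: "C \<subseteq> D" and tot: "\<And>G H. G \<in> C \<Longrightarrow> H \<in> C \<Longrightarrow> G \<le> H \<or> H \<le> G"
        using C by (auto simp: Chains_def relation_of_def)
      have "eventually P (Inf C) \<longleftrightarrow> (\<exists>G\<in>C. eventually P G)" for P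
        by (rule eventually_Inf_base[OF False]) (metis inf.orderE le_inf_iff order_refl tot)
      then have "Inf C \<noteq> bot"
        using CD by (auto simp: trivial_limit_def D_def)
      moreover have "Inf C \<le> F"
        using False CD by (auto simp: D_def intro: Inf_lower2)
      ultimately show ?thesis
        by (auto simp: D_def intro!: bexI[of _ "Inf C"] Inf_lower)
    qed
  qed
  then obtain U where U: "U \<le> F" "U \<noteq> bot" and max: "\<And>G. G \<le> U \<Longrightarrow> G \<noteq> bot \<Longrightarrow> G = U"
    unfolding D_def by (blast intro: order_trans)
  have "eventually P U \<or> eventually (\<lambda>x. \<not> P x) U" for P
  proof (cases "inf U (principal {x. P x}) = bot")
    case True
    then show ?thesis
      by (simp add: trivial_limit_def eventually_inf_principal)
  next
    case False
    then have "inf U (principal {x. P x}) = U" by (intro max) auto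
    then have "U \<le> principal {x. P x}" by (metis inf.cobounded2)
    then show ?thesis by (simp add: le_principal)
  qed
  then show ?thesis using that U by blast
qed

text \<open>
  Compactness of an interval yields a cluster point of the sequence; along an ultrafilter a cluster
  point is a limit, since a neighbourhood that is not eventually avoided is eventually entered.
\<close>

lemma bounded_tendsto_along_ultrafilter:
  fixes f :: "nat \<Rightarrow> real"
  assumes U: "U \<noteq> bot" "\<And>P. eventually P U \<or> eventually (\<lambda>x. \<not> P x) U"
    and f: "\<And>n. \<bar>f n\<bar> \<le> C"
  obtains l where "(f \<longlongrightarrow> l) U"
proof -
  have "eventually (\<lambda>x. x \<in> {-C..C}) (filtermap f U)"
    using f by (auto simp: eventually_filtermap abs_le_iff minus_le_iff intro!: always_eventually)
  moreover have "filtermap f U \<noteq> bot" using U(1) by (simp add: filtermap_bot_iff)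
  ultimately obtain l where l: "inf (nhds l) (filtermap f U) \<noteq> bot"
    using compact_Icc[of "-C" C] unfolding compact_filter by blast
  have "(f \<longlongrightarrow> l) U"
    unfolding tendsto_def
  proof (intro allI impI)
    fix S assume "open S" "l \<in> S"
    then have S: "eventually (\<lambda>x. x \<in> S) (nhds l)" by (simp add: eventually_nhds_in_open)
    have "\<not> eventually (\<lambda>x. f x \<notin> S) U"
    proof
      assume "eventually (\<lambda>x. f x \<notin> S) U"
      then have "eventually (\<lambda>x. x \<notin> S) (filtermap f U)" by (simp add: eventually_filtermap)
      with S have "eventually (\<lambda>x. False) (inf (nhds l) (filtermap f U))"
        unfolding eventually_inf by blast
      with l show False by (simp add: trivial_limit_def)
    qed
    then show "eventually (\<lambda>x. f x \<in> S) U" using U(2) by blast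
  qed
  then show ?thesis using that by blast
qed

section \<open>A finitely additive mean on the finite sets of natural numbers\<close>

definition ultra :: "nat filter" where
  "ultra = (SOME U. U \<le> sequentially \<and> U \<noteq> bot \<and>
     (\<forall>P. eventually P U \<or> eventually (\<lambda>x. \<not> P x) U))"

lemma ultra: "ultra \<le> sequentially" "ultra \<noteq> bot"
    "eventually P ultra \<or> eventually (\<lambda>x. \<not> P x) ultra"
proof -
  obtain U :: "nat filter" where "U \<le> sequentially \<and> U \<noteq> bot \<and>
     (\<forall>P. eventually P U \<or> eventually (\<lambda>x. \<not> P x) U)"
    using ultrafilter_below[of sequentially] by (metis sequentially_bot)
  then have "ultra \<le> sequentially \<and> ultra \<noteq> bot \<and>
     (\<forall>P. eventually P ultra \<or> eventually (\<lambda>x. \<not> P x) ultra)"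
    unfolding ultra_def by (rule someI)
  then show "ultra \<le> sequentially" "ultra \<noteq> bot"
    "eventually P ultra \<or> eventually (\<lambda>x. \<not> P x) ultra" by auto
qed

text \<open>
  The mean behaves linearly only on bounded functions; this predicate carries that side condition.
\<close>

definition bdd :: "('a \<Rightarrow> real) \<Rightarrow> bool" where
  "bdd f \<longleftrightarrow> (\<exists>C. \<forall>x. \<bar>f x\<bar> \<le> C)"

lemma bddI: "(\<And>x. \<bar>f x\<bar> \<le> C) \<Longrightarrow> bdd f"
  unfolding bdd_def by blast

lemma bdd_const [intro, simp]: "bdd (\<lambda>_. c)"
  by (auto simp: bdd_def)

lemma bdd_add [intro, simp]: "bdd f \<Longrightarrow> bdd g \<Longrightarrow> bdd (\<lambda>x. f x + g x)"
  unfolding bdd_def by (meson abs_triangle_ineq add_mono order_trans)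

lemma bdd_mult [intro, simp]:
  assumes "bdd f" "bdd g" shows "bdd (\<lambda>x. f x * g x)"
proof -
  obtain C D where "\<And>x. \<bar>f x\<bar> \<le> C" "\<And>x. \<bar>g x\<bar> \<le> D" using assms by (auto simp: bdd_def)
  then have "\<bar>f x * g x\<bar> \<le> C * D" for x
    by (simp add: abs_mult mult_mono')
  then show ?thesis by (rule bddI)
qed

lemma bdd_sum [intro, simp]: "(\<And>i. i \<in> I \<Longrightarrow> bdd (f i)) \<Longrightarrow> bdd (\<lambda>x. \<Sum>i\<in>I. f i x)"
  by (induction I rule: infinite_finite_induct) auto

lemma bdd_power [intro, simp]: "bdd f \<Longrightarrow> bdd (\<lambda>x. f x ^ n)"
  by (induction n) auto

lemma bdd_divide [intro, simp]: "bdd f \<Longrightarrow> bdd (\<lambda>x. f x / c)"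
  using bdd_mult[of f "\<lambda>_. 1 / c"] by simp

text \<open>
  The finite sets of natural numbers form, under symmetric difference, the direct sum of countably
  many copies of the group of order two, and \<open>Pow {..<m}\<close> is the subgroup of its first \<open>m\<close> copies.
  Averaging over these subgroups and passing to the limit gives an invariant mean. Finite sets are
  coded by natural numbers, so that a bounded sequence becomes a bounded function on this group.
  The mean is only finitely additive: a countably additive probability on a countable set would be
  atomic, and the coefficient operators below would then be compact.
\<close>

definition cube_avg :: "nat \<Rightarrow> (nat set \<Rightarrow> real) \<Rightarrow> real" where
  "cube_avg m f = (\<Sum>T\<in>Pow {..<m}. f T) / 2 ^ m"

definition mean :: "(nat set \<Rightarrow> real) \<Rightarrow> real" where
  "mean f = Lim ultra (\<lambda>m. cube_avg m f)"

lemma cube_avg_mono: "(\<And>T. finite T \<Longrightarrow> f T \<le> g T) \<Longrightarrow> cube_avg m f \<le> cube_avg m g"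
  unfolding cube_avg_def by (intro divide_right_mono sum_mono) (auto intro: finite_subset)

lemma cube_avg_const: "cube_avg m (\<lambda>_. c) = c"
  by (simp add: cube_avg_def card_Pow)

lemma tendsto_mean:
  assumes "bdd f" shows "((\<lambda>m. cube_avg m f) \<longlongrightarrow> mean f) ultra"
proof -
  obtain C where C: "\<And>x. \<bar>f x\<bar> \<le> C" using assms by (auto simp: bdd_def)
  have "\<bar>cube_avg m f\<bar> \<le> C" for m
    using cube_avg_mono[of f "\<lambda>_. C" m] cube_avg_mono[of "\<lambda>_. - C" f m] C
    by (auto simp: cube_avg_const abs_le_iff minus_le_iff)
  then obtain l where "((\<lambda>m. cube_avg m f) \<longlongrightarrow> l) ultra"
    using bounded_tendsto_along_ultrafilter[OF ultra(2,3), of "\<lambda>m. cube_avg m f" C] by blast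
  then show ?thesis
    unfolding mean_def using tendsto_Lim[OF ultra(2)] by auto
qed

lemma mean_unique: "((\<lambda>m. cube_avg m f) \<longlongrightarrow> l) ultra \<Longrightarrow> mean f = l"
  unfolding mean_def by (rule tendsto_Lim[OF ultra(2)])

lemma mean_eventually_const:
  assumes "\<And>m. m \<ge> l \<Longrightarrow> cube_avg m f = c"
  shows "mean f = c"
proof (rule mean_unique)
  have "\<forall>\<^sub>F m in sequentially. cube_avg m f = c"
    using assms by (auto simp: eventually_sequentially)
  then have "\<forall>\<^sub>F m in ultra. cube_avg m f = c"
    using ultra(1) by (simp add: le_filter_def)
  then show "((\<lambda>m. cube_avg m f) \<longlongrightarrow> c) ultra"
    by (rule tendsto_eventually)
qed

lemma mean_add: "bdd f \<Longrightarrow> bdd g \<Longrightarrow> mean (\<lambda>x. f x + g x) = mean f + mean g"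
  by (rule mean_unique)
    (use tendsto_add[OF tendsto_mean tendsto_mean] in
      \<open>simp add: cube_avg_def sum.distrib add_divide_distrib\<close>)

lemma mean_cmult: "bdd f \<Longrightarrow> mean (\<lambda>x. c * f x) = c * mean f"
  by (rule mean_unique)
    (use tendsto_mult_left[OF tendsto_mean, of f c] in
      \<open>simp add: cube_avg_def flip: sum_distrib_left\<close>)

lemma mean_const [simp]: "mean (\<lambda>_. c) = c"
  by (rule mean_eventually_const) (rule cube_avg_const)

lemma mean_sum: "(\<And>i. i \<in> I \<Longrightarrow> bdd (f i)) \<Longrightarrow> mean (\<lambda>x. \<Sum>i\<in>I. f i x) = (\<Sum>i\<in>I. mean (f i))"
  by (induction I rule: infinite_finite_induct) (auto simp: mean_add)

lemma mean_mono:
  assumes "bdd f" "bdd g" "\<And>T. finite T \<Longrightarrow> f T \<le> g T"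
  shows "mean f \<le> mean g"
  by (rule tendsto_le[OF ultra(2) tendsto_mean[OF assms(2)] tendsto_mean[OF assms(1)]])
    (simp add: assms cube_avg_mono)

text \<open>
  Among the subsets of \<open>{..<m}\<close> with \<open>m \<ge> l\<close>, exactly \<open>2 ^ (m - l)\<close> have a given trace on \<open>{..<l}\<close>.
\<close>

lemma mean_cylinder:
  assumes "y \<subseteq> {..<l}"
  shows "mean (\<lambda>T. of_bool (T \<inter> {..<l} = y)) = 1 / 2 ^ l"
proof (rule mean_eventually_const)
  fix m assume "l \<le> m"
  have "bij_betw (\<lambda>R. y \<union> R) (Pow {l..<m}) {T \<in> Pow {..<m}. T \<inter> {..<l} = y}"
  proof (rule bij_betw_byWitness[where f' = "\<lambda>T. T - {..<l}"])
    show "\<forall>a\<in>Pow {l..<m}. y \<union> a - {..<l} = a" using assms by fastforce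
  next
    show "\<forall>a'\<in>{T \<in> Pow {..<m}. T \<inter> {..<l} = y}. y \<union> (a' - {..<l}) = a'" by blast
  next
    show "(\<union>) y ` Pow {l..<m} \<subseteq> {T \<in> Pow {..<m}. T \<inter> {..<l} = y}"
    proof safe
      fix R x assume "R \<subseteq> {l..<m}" "x \<in> y"
      then show "x < m" using assms \<open>l \<le> m\<close> by fastforce
    next
      fix R x assume "R \<subseteq> {l..<m}" "x \<in> R"
      then show "x < m" by fastforce
    next
      fix R x assume "R \<subseteq> {l..<m}" "x \<in> R" "x < l"
      then show "x \<in> y" by fastforce
    next
      fix R x assume "x \<in> y"
      then show "x < l" using assms by fastforce
    qed
  qed auto
  then have "card {T \<in> Pow {..<m}. T \<inter> {..<l} = y} = 2 ^ (m - l)"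
    by (metis bij_betw_same_card card_Pow card_atLeastLessThan finite_atLeastLessThan)
  moreover have "{T. T \<subseteq> {..<m} \<and> T \<inter> {..<l} = y} = {T \<in> Pow {..<m}. T \<inter> {..<l} = y}" by auto
  ultimately show "cube_avg m (\<lambda>T. of_bool (T \<inter> {..<l} = y)) = 1 / 2 ^ l"
    using \<open>l \<le> m\<close>
      by (simp add: cube_avg_def of_bool_def sum.If_cases Int_def field_simps flip: power_add)
qed

section \<open>Walsh functions\<close>

text \<open>
  These are the characters of the group of finite sets: \<open>walsh B\<close> is the product of the independent
  Rademacher signs with indices in \<open>B\<close>.
\<close>

definition walsh :: "nat set \<Rightarrow> nat set \<Rightarrow> real" where
  "walsh B T = (-1) ^ card (B \<inter> T)"

lemma walsh_empty [simp]: "walsh {} T = 1"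
  by (simp add: walsh_def)

lemma abs_walsh [simp]: "\<bar>walsh B T\<bar> = 1"
  by (simp add: walsh_def power_abs)

lemma walsh_square [simp]: "walsh B T * walsh B T = 1"
  by (simp add: walsh_def flip: power_mult_distrib)

lemma bdd_walsh [intro, simp]: "bdd (walsh B)"
  by (rule bddI[of _ 1]) simp

lemma walsh_sym_diff:
  assumes "finite A" "finite B"
  shows "walsh (sym_diff A B) T = walsh A T * walsh B T"
proof -
  have "card (A \<inter> T) = card ((A - B) \<inter> T) + card (A \<inter> B \<inter> T)"
    using assms by (subst card_Un_disjoint[symmetric]) (auto intro: arg_cong[where f = card])
  moreover have "card (B \<inter> T) = card ((B - A) \<inter> T) + card (A \<inter> B \<inter> T)"
    using assms by (subst card_Un_disjoint[symmetric]) (auto intro: arg_cong[where f = card])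
  moreover have "card (sym_diff A B \<inter> T) = card ((A - B) \<inter> T) + card ((B - A) \<inter> T)"
    using assms by (subst card_Un_disjoint[symmetric]) (auto intro: arg_cong[where f = card])
  ultimately show ?thesis
    by (auto simp: walsh_def power_add simp flip: power_mult_distrib)
qed

text \<open>
  Adding or removing one fixed element of \<open>B \<inter> X\<close> permutes \<open>Pow X\<close> and flips every sign.
\<close>

lemma sum_Pow_walsh:
  assumes "finite X" "B \<inter> X \<noteq> {}" "finite B"
  shows "(\<Sum>T\<in>Pow X. walsh B T) = 0"
proof -
  obtain j where j: "j \<in> B" "j \<in> X" using assms by blast
  have "(\<Sum>T\<in>Pow X. walsh B T) = (\<Sum>T\<in>Pow X. walsh B (sym_diff {j} T))"
    by (rule sum.reindex_bij_witness[of _ "\<lambda>T. sym_diff {j} T" "\<lambda>T. sym_diff {j} T"])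
      (use j in \<open>auto intro!: arg_cong[where f = "walsh B"]\<close>)
  also have "\<dots> = (\<Sum>T\<in>Pow X. - walsh B T)"
  proof (rule sum.cong)
    fix T assume "T \<in> Pow X"
    then have "finite T" using assms finite_subset by auto
    have "walsh B (sym_diff {j} T) = walsh (sym_diff {j} T) B"
      by (simp add: walsh_def Int_commute)
    also have "\<dots> = walsh {j} B * walsh T B"
      using \<open>finite T\<close> by (intro walsh_sym_diff) auto
    also have "\<dots> = - walsh B T"
      using j by (simp add: walsh_def Int_commute)
    finally show "walsh B (sym_diff {j} T) = - walsh B T" .
  qed simp
  finally show ?thesis by (simp add: sum_negf)
qed

lemma mean_walsh:
  assumes "finite B" "B \<noteq> {}" shows "mean (walsh B) = 0"
proof (rule mean_eventually_const)
  fix m assume "Suc (Max B) \<le> m"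
  then have "B \<subseteq> {..<m}" using assms(1) by (auto simp: Suc_le_eq dest: Max_ge[OF assms(1)])
  then have "B \<inter> {..<m} \<noteq> {}" using assms by auto
  then show "cube_avg m (walsh B) = 0"
    unfolding cube_avg_def using assms by (simp add: sum_Pow_walsh)
qed

section \<open>Moments of independent Walsh functions\<close>

text \<open>
  \<open>combos S a\<close> contains the sums of at most \<open>a\<close> members of \<open>S\<close>, repetitions allowed, in the group
  of finite sets with symmetric difference. If \<open>A k\<close> is never such a sum of earlier \<open>A j\<close>, then the
  functions \<open>walsh (A k)\<close> behave like independent signs in all products of at most \<open>a + 1\<close> factors.
\<close>

primrec combos :: "nat set set \<Rightarrow> nat \<Rightarrow> nat set set" where
  "combos S 0 = {{}}"
| "combos S (Suc a) = combos S a \<union> (\<Union>A\<in>S. sym_diff A ` combos S a)"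

lemma combos_mono:
  assumes "S \<subseteq> S'" "a \<le> b" shows "combos S a \<subseteq> combos S' b"
proof -
  have "combos S a \<subseteq> combos S' a"
    by (induction a) (use assms(1) in auto)
  also have "\<dots> \<subseteq> combos S' b"
    using assms(2) by (rule lift_Suc_mono_le[rotated]) auto
  finally show ?thesis .
qed

lemma finite_card_combos:
  assumes "finite S" shows "finite (combos S a) \<and> card (combos S a) \<le> (card S + 1) ^ a"
proof (induction a)
  case (Suc a)
  have "card (\<Union>A\<in>S. sym_diff A ` combos S a) \<le> (\<Sum>A\<in>S. card (sym_diff A ` combos S a))"
    using assms Suc by (intro card_UN_le) auto
  also have "\<dots> \<le> (\<Sum>A\<in>S. (card S + 1) ^ a)"
    using Suc by (intro sum_mono order_trans[OF card_image_le]) auto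
  finally have "card (\<Union>A\<in>S. sym_diff A ` combos S a) \<le> card S * (card S + 1) ^ a" by simp
  then have "card (combos S (Suc a)) \<le> (card S + 1) ^ a + card S * (card S + 1) ^ a"
    using Suc by (auto intro!: order_trans[OF card_Un_le] add_mono)
  then show ?case using Suc assms by simp
qed simp

text \<open>
  Multiplying by one more factor \<open>\<Sum>k\<in>F. z k * walsh (A k) T\<close> replaces \<open>B\<close> by the sets
  \<open>sym_diff (A k) B\<close>. After \<open>a\<close> steps none of them can be empty, since otherwise \<open>B\<close> would be a sum
  of \<open>a\<close> of the sets \<open>A k\<close>; and a nontrivial character has mean zero.
\<close>

lemma mean_power_walsh_eq_0:
  assumes "finite F" "\<And>k. k \<in> F \<Longrightarrow> finite (A k)"
  shows "finite B \<Longrightarrow> B \<notin> combos (A ` F) a \<Longrightarrow>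
    mean (\<lambda>T. (\<Sum>k\<in>F. z k * walsh (A k) T) ^ a * walsh B T) = 0"
proof (induction a arbitrary: B)
  case 0
  then show ?case by (simp add: mean_walsh)
next
  case (Suc a)
  let ?h = "\<lambda>T. \<Sum>k\<in>F. z k * walsh (A k) T"
  have "?h T ^ Suc a * walsh B T = (\<Sum>k\<in>F. z k * (?h T ^ a * walsh (sym_diff (A k) B) T))" for T
  proof -
    have "(\<Sum>k\<in>F. z k * (?h T ^ a * walsh (sym_diff (A k) B) T))
        = (\<Sum>k\<in>F. z k * walsh (A k) T * (?h T ^ a * walsh B T))"
      using assms Suc.prems by (intro sum.cong refl) (simp add: walsh_sym_diff mult_ac)
    also have "\<dots> = ?h T * (?h T ^ a * walsh B T)" by (simp only: sum_distrib_right)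
    finally show ?thesis by (simp add: mult_ac)
  qed
  then have "mean (\<lambda>T. ?h T ^ Suc a * walsh B T)
      = (\<Sum>k\<in>F. z k * mean (\<lambda>T. ?h T ^ a * walsh (sym_diff (A k) B) T))"
    by (simp only:) (subst mean_sum, auto simp: mean_cmult)
  also have "\<dots> = (\<Sum>k\<in>F. z k * 0)"
  proof (intro sum.cong refl arg_cong2[where f = "(*)"] Suc.IH)
    fix k assume "k \<in> F"
    then show "finite (sym_diff (A k) B)" using assms Suc.prems by auto
    have inv: "sym_diff (A k) (sym_diff (A k) B) = B" by auto
    show "sym_diff (A k) B \<notin> combos (A ` F) a"
    proof
      assume "sym_diff (A k) B \<in> combos (A ` F) a"
      then have "sym_diff (A k) (sym_diff (A k) B) \<in> sym_diff (A k) ` combos (A ` F) a"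
        by (rule imageI)
      then have "B \<in> sym_diff (A k) ` combos (A ` F) a" unfolding inv .
      then show False
        using Suc.prems(2) \<open>k \<in> F\<close> unfolding combos.simps by blast
    qed
  qed
  finally show ?case by simp
qed

text \<open>
  Since \<open>(2s)! / s! = 2 ^ s (2s - 1)!!\<close>, this is \<open>2 ^ s\<close> times the Gaussian moment of order \<open>2s\<close>.
  The extra factor leaves room for the short induction in Khintchine's inequality below.
\<close>

definition moment_const :: "nat \<Rightarrow> real" where
  "moment_const s = fact (2 * s) / fact s"

lemma binomial_moment_const:
  assumes "j \<le> s"
  shows "real ((2 * s) choose (2 * j)) * moment_const (s - j) \<le> moment_const s * real (s choose j)"
proof -
  have "real ((2 * s) choose (2 * j)) * moment_const (s - j)
      = fact (2 * s) / (fact (2 * j) * fact (2 * (s - j))) * (fact (2 * (s - j)) / fact (s - j))"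
    using assms by (simp add: binomial_fact moment_const_def diff_mult_distrib2)
  also have "\<dots> = fact (2 * s) / (fact (2 * j) * fact (s - j))" by simp
  also have "\<dots> \<le> fact (2 * s) / (fact j * fact (s - j))"
    by (intro divide_left_mono mult_right_mono fact_mono) auto
  also have "\<dots> = moment_const s * real (s choose j)"
    using assms by (simp add: binomial_fact moment_const_def)
  finally show ?thesis .
qed

lemma sum_even_odd: "(\<Sum>i\<le>2 * s. f i) = (\<Sum>j\<le>s. f (2 * j)) + (\<Sum>j<s. f (Suc (2 * j)))"
  for f :: "nat \<Rightarrow> real"
  by (induction s) (auto simp: algebra_simps)

lemma walsh_even_power [simp]: "walsh B T ^ (2 * j) = 1"
  by (simp add: walsh_def flip: power_mult)

text \<open>
  Khintchine's inequality for even exponents. Adjoin the largest index \<open>k\<close> to \<open>F\<close> and expand the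
  power binomially: odd powers of \<open>walsh (A k)\<close> have mean zero against the remaining powers by
  independence, even powers equal \<open>1\<close>, and the inequality between binomial coefficients above turns the
  result into the expansion of \<open>moment_const r * (z k ^ 2 + \<Sum>j\<in>F. z j ^ 2) ^ r\<close>. All exponents up to
  \<open>2s\<close> are treated together, because the expansion uses the lower moments.
\<close>

lemma mean_even_power_le:
  fixes F :: "nat set" and A :: "nat \<Rightarrow> nat set"
  assumes "finite F" "\<And>k. finite (A k)"
    and indep: "\<And>k. k \<in> F \<Longrightarrow> A k \<notin> combos (A ` {..<k}) (2 * s - 1)"
  shows "mean (\<lambda>T. (\<Sum>k\<in>F. z k * walsh (A k) T) ^ (2 * s)) \<le> moment_const s * (\<Sum>k\<in>F. z k ^ 2) ^ s"
proof -
  have all_moments: "r \<le> s \<Longrightarrow> mean (\<lambda>T. (\<Sum>k\<in>F. z k * walsh (A k) T) ^ (2 * r))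
      \<le> moment_const r * (\<Sum>k\<in>F. z k ^ 2) ^ r" for r
    using assms(1) indep
  proof (induction F arbitrary: r rule: finite_linorder_max_induct)
    case empty
    then show ?case by (cases r) (auto simp: moment_const_def)
  next
    case (insert k F)
    let ?h = "\<lambda>T. \<Sum>k\<in>F. z k * walsh (A k) T"
    let ?v = "\<Sum>k\<in>F. z k ^ 2"
    have k: "k \<notin> F" using insert by blast
    have zp: "z k ^ (2 * j) = (z k ^ 2) ^ j" for j by (rule power_mult)
    have odd: "mean (\<lambda>T. real (2 * r choose Suc (2 * j)) * (z k * walsh (A k) T) ^ Suc (2 * j) *
        ?h T ^ (2 * r - Suc (2 * j))) = 0" if "j < r" for j
    proof -
      have "A k \<notin> combos (A ` F) (2 * r - Suc (2 * j))"
        using insert.prems(2)[of k] insert.hyps combos_mono[of "A ` F" "A ` {..<k}" "2 * r - Suc (2 * j)" "2 * s - 1"]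
          \<open>r \<le> s\<close> by fastforce
      then have "mean (\<lambda>T. ?h T ^ (2 * r - Suc (2 * j)) * walsh (A k) T) = 0"
        using insert.hyps assms(2) by (intro mean_power_walsh_eq_0) auto
      moreover have "real (2 * r choose Suc (2 * j)) * (z k * walsh (A k) T) ^ Suc (2 * j) *
          ?h T ^ (2 * r - Suc (2 * j)) = (real (2 * r choose Suc (2 * j)) * z k ^ Suc (2 * j)) *
          (?h T ^ (2 * r - Suc (2 * j)) * walsh (A k) T)" for T
      proof -
        have "(z k * walsh (A k) T) ^ Suc (2 * j) = z k ^ Suc (2 * j) * walsh (A k) T"
          by (simp add: power_mult_distrib)
        then show ?thesis by (simp only: mult_ac)
      qed
      ultimately show ?thesis by (simp only:) (subst mean_cmult, auto)
    qed
    have "(\<Sum>k\<in>insert k F. z k * walsh (A k) T) ^ (2 * r)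
        = (\<Sum>i\<le>2 * r. real (2 * r choose i) * (z k * walsh (A k) T) ^ i * ?h T ^ (2 * r - i))" for T
      unfolding sum.insert[OF insert.hyps(1) k] by (rule binomial_ring)
    then have "mean (\<lambda>T. (\<Sum>k\<in>insert k F. z k * walsh (A k) T) ^ (2 * r))
        = mean (\<lambda>T. \<Sum>i\<le>2 * r. real (2 * r choose i) * (z k * walsh (A k) T) ^ i * ?h T ^ (2 * r - i))"
      by simp
    also have "\<dots>
        = (\<Sum>i\<le>2 * r. mean (\<lambda>T. real (2 * r choose i) * (z k * walsh (A k) T) ^ i * ?h T ^ (2 * r - i)))"
      by (intro mean_sum) auto
    also have "\<dots>
        = (\<Sum>j\<le>r. mean (\<lambda>T. real (2 * r choose (2 * j)) * (z k * walsh (A k) T) ^ (2 * j) * ?h T ^ (2 * r - 2 * j)))"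
      using odd by (subst sum_even_odd) (simp del: power_Suc)
    also have "\<dots>
        = (\<Sum>j\<le>r. real (2 * r choose (2 * j)) * z k ^ (2 * j) * mean (\<lambda>T. ?h T ^ (2 * (r - j))))"
      by (intro sum.cong refl, subst mean_cmult[symmetric])
        (auto simp: power_mult_distrib diff_mult_distrib2)
    also have "\<dots>
        \<le> (\<Sum>j\<le>r. real (2 * r choose (2 * j)) * z k ^ (2 * j) * (moment_const (r - j) * ?v ^ (r - j)))"
      using insert.prems
        by (intro sum_mono mult_left_mono insert.IH) (auto intro!: mult_nonneg_nonneg)
    also have "\<dots>
        = (\<Sum>j\<le>r. (real (2 * r choose (2 * j)) * moment_const (r - j)) * ((z k ^ 2) ^ j * ?v ^ (r - j)))"
      unfolding zp by (simp only: mult_ac)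
    also have "\<dots> \<le> (\<Sum>j\<le>r. (moment_const r * real (r choose j)) * ((z k ^ 2) ^ j * ?v ^ (r - j)))"
    proof (rule sum_mono)
      fix j assume "j \<in> {..r}"
      have "0 \<le> (z k ^ 2) ^ j * ?v ^ (r - j)"
        by (intro mult_nonneg_nonneg zero_le_power sum_nonneg zero_le_power2)
      then show "real (2 * r choose (2 * j)) * moment_const (r - j) * ((z k ^ 2) ^ j * ?v ^ (r - j))
          \<le> moment_const r * real (r choose j) * ((z k ^ 2) ^ j * ?v ^ (r - j))"
        using \<open>j \<in> {..r}\<close> by (intro mult_right_mono binomial_moment_const) auto
    qed
    also have "\<dots> = moment_const r * (z k ^ 2 + ?v) ^ r"
      unfolding binomial_ring[of "z k ^ 2" ?v r] sum_distrib_left by (simp only: mult_ac)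
    finally show ?case unfolding sum.insert[OF insert.hyps(1) k, of "\<lambda>k. z k ^ 2"] .
  qed
  show ?thesis by (rule all_moments) simp
qed

text \<open>
  At step \<open>k\<close> at most \<open>(k + 1) ^ d k\<close> sets are forbidden, fewer than there are subsets of \<open>{..<l k}\<close>.
\<close>

lemma greedy_independent_sets:
  fixes d l :: "nat \<Rightarrow> nat"
  assumes "\<And>k. (k + 1) ^ d k < 2 ^ l k"
  obtains A :: "nat \<Rightarrow> nat set" where "\<And>k. A k \<subseteq> {..<l k}" "\<And>k. A k \<notin> combos (A ` {..<k}) (d k)"
proof -
  have ex: "\<exists>B. B \<subseteq> {..<l k} \<and> B \<notin> combos (f ` {..<k}) (d k)" for f :: "nat \<Rightarrow> nat set" and k
  proof (rule ccontr)
    assume "\<not> ?thesis"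
    then have "Pow {..<l k} \<subseteq> combos (f ` {..<k}) (d k)" by auto
    then have "2 ^ l k \<le> card (combos (f ` {..<k}) (d k))"
      using card_mono[of "combos (f ` {..<k}) (d k)" "Pow {..<l k}"]
        finite_card_combos[of "f ` {..<k}" "d k"] by (simp add: card_Pow)
    also have "\<dots> \<le> (card (f ` {..<k}) + 1) ^ d k"
      using finite_card_combos[of "f ` {..<k}" "d k"] by simp
    also have "\<dots> \<le> (k + 1) ^ d k"
      using card_image_le[of "{..<k}" f] by (intro power_mono) auto
    finally show False using assms[of k] by simp
  qed
  have "\<exists>A. \<forall>k. A k \<subseteq> {..<l k} \<and> A k \<notin> combos (A ` {..<k}) (d k)"
  proof (rule dependent_wellorder_choice)
    fix r and f g :: "nat \<Rightarrow> nat set" and k :: nat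
    assume "\<And>j. j < k \<Longrightarrow> f j = g j"
    then have "f ` {..<k} = g ` {..<k}" by auto
    then show "(r \<subseteq> {..<l k} \<and> r \<notin> combos (f ` {..<k}) (d k))
        = (r \<subseteq> {..<l k} \<and> r \<notin> combos (g ` {..<k}) (d k))"
      by simp
  qed (use ex in blast)
  then show ?thesis using that by blast
qed

section \<open>Operators that are small along the diagonal of a matrix\<close>

text \<open>
  For scalar sequences \<open>b y\<close> this says that \<open>\<Sum>y\<in>Y. \<bar>b y n\<bar> \<le> 1\<close> for every \<open>n\<close>; in general it says that
  \<open>b\<close> induces a contraction from the finite-dimensional \<open>l\<^sub>\<infinity>\<close> space over \<open>Y\<close>.
\<close>

definition sign_bounded :: "'y set \<Rightarrow> ('y \<Rightarrow> 'a::real_normed_vector) \<Rightarrow> bool" where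
  "sign_bounded Y b \<longleftrightarrow> (\<forall>s. (\<forall>y\<in>Y. \<bar>s y\<bar> \<le> 1) \<longrightarrow> norm (\<Sum>y\<in>Y. s y *\<^sub>R b y) \<le> 1)"

text \<open>
  The matrix \<open>u\<close> tests whether \<open>T\<close> can reproduce it: \<open>T\<close> is fed with vectors \<open>b y\<close>, read off by
  functionals \<open>a i\<close>, and the resulting matrix is paired with \<open>u\<close>. Absolute values are
  taken separately for each \<open>y\<close>, so that passing to a smaller \<open>G\<close> decreases the sum and the exceptional
  sets of two operators can be united. Discarding a few \<open>y\<close> matters: functionals adapted to one
  particular \<open>y\<close>, such as \<open>a i = u i y *\<^sub>R f\<close> with entries \<open>u i y\<close> of modulus \<open>1\<close>, give this \<open>y\<close> alone the
  contribution \<open>card I * \<bar>f (T (b y))\<bar>\<close>.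
\<close>

definition diagonal_small ::
    "'y set \<Rightarrow> 'i set \<Rightarrow> ('i \<Rightarrow> 'y \<Rightarrow> real) \<Rightarrow> real \<Rightarrow>
     ('a::real_normed_vector \<Rightarrow>\<^sub>L 'b::real_normed_vector) \<Rightarrow> bool" where
  "diagonal_small Y I u e T \<longleftrightarrow>
     (\<forall>b a. sign_bounded Y b \<longrightarrow> (\<forall>i\<in>I. norm (a i) \<le> 1) \<longrightarrow>
       (\<exists>G\<subseteq>Y. real (card (Y - G)) \<le> e * real (card Y) \<and>
          (\<Sum>y\<in>G. \<bar>\<Sum>i\<in>I. u i y * blinfun_apply (a i) (blinfun_apply T (b y))\<bar>) \<le> e * real (card I)))"

lemma diagonal_smallD:
  assumes "diagonal_small Y I u e T" "sign_bounded Y b" "\<forall>i\<in>I. norm (a i) \<le> 1"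
  shows "\<exists>G\<subseteq>Y. real (card (Y - G)) \<le> e * real (card Y) \<and>
    (\<Sum>y\<in>G. \<bar>\<Sum>i\<in>I. u i y * blinfun_apply (a i) (blinfun_apply T (b y))\<bar>) \<le> e * real (card I)"
  by (rule assms(1)[unfolded diagonal_small_def, rule_format, OF assms(2)]) (use assms(3) in blast)

lemma diagonal_small_add:
  fixes S T :: "'a::real_normed_vector \<Rightarrow>\<^sub>L 'b::real_normed_vector"
  assumes "finite Y" "diagonal_small Y I u e S" "diagonal_small Y I u e' T"
  shows "diagonal_small Y I u (e + e') (S + T)"
  unfolding diagonal_small_def
proof (intro allI impI)
  fix b :: "_ \<Rightarrow> 'a" and a :: "_ \<Rightarrow> 'b \<Rightarrow>\<^sub>L real"
  assume ba: "sign_bounded Y b" "\<forall>i\<in>I. norm (a i) \<le> 1"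
  let ?f = "\<lambda>T y. \<Sum>i\<in>I. u i y * blinfun_apply (a i) (blinfun_apply T (b y))"
  obtain G where G: "G \<subseteq> Y" "real (card (Y - G)) \<le> e * real (card Y)"
    "(\<Sum>y\<in>G. \<bar>?f S y\<bar>) \<le> e * real (card I)"
    using diagonal_smallD[OF assms(2) ba] by blast
  obtain H where H: "H \<subseteq> Y" "real (card (Y - H)) \<le> e' * real (card Y)"
    "(\<Sum>y\<in>H. \<bar>?f T y\<bar>) \<le> e' * real (card I)"
    using diagonal_smallD[OF assms(3) ba] by blast
  have fin: "finite G" "finite H" using G H assms(1) finite_subset by auto
  show "\<exists>G\<subseteq>Y. real (card (Y - G)) \<le> (e + e') * real (card Y) \<and>
      (\<Sum>y\<in>G. \<bar>?f (S + T) y\<bar>) \<le> (e + e') * real (card I)"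
  proof (intro exI[of _ "G \<inter> H"] conjI)
    have "card (Y - G \<inter> H) \<le> card (Y - G) + card (Y - H)"
      using card_Un_le[of "Y - G" "Y - H"] by (simp add: Diff_Int)
    then show "real (card (Y - G \<inter> H)) \<le> (e + e') * real (card Y)"
      using G(2) H(2) by (simp add: distrib_right)
    have "(\<Sum>y\<in>G \<inter> H. \<bar>?f (S + T) y\<bar>) \<le> (\<Sum>y\<in>G \<inter> H. \<bar>?f S y\<bar> + \<bar>?f T y\<bar>)"
      by (intro sum_mono)
        (simp add: blinfun.add_left blinfun.add_right distrib_left sum.distrib abs_triangle_ineq)
    also have "\<dots> \<le> (\<Sum>y\<in>G. \<bar>?f S y\<bar>) + (\<Sum>y\<in>H. \<bar>?f T y\<bar>)"
      unfolding sum.distrib using fin by (intro add_mono sum_mono2) auto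
    finally show "(\<Sum>y\<in>G \<inter> H. \<bar>?f (S + T) y\<bar>) \<le> (e + e') * real (card I)"
      using G(3) H(3) by (simp add: distrib_right)
  qed (use G H in auto)
qed

text \<open>
  The vectors \<open>Q (b y)\<close> and the functionals \<open>a i o\<^sub>L R\<close> are again admissible after division by \<open>norm Q\<close>
  and \<open>norm R\<close>.
\<close>

lemma diagonal_small_compose:
  fixes R :: "'c::real_normed_vector \<Rightarrow>\<^sub>L 'd::real_normed_vector"
    and Q :: "'a::real_normed_vector \<Rightarrow>\<^sub>L 'b::real_normed_vector"
  assumes T: "diagonal_small Y I u e T" and "norm R * norm Q \<le> C" "1 \<le> C"
    and "0 \<le> e"
  shows "diagonal_small Y I u (C * e) (R o\<^sub>L T o\<^sub>L Q)"
  unfolding diagonal_small_def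
proof (intro allI impI)
  fix b :: "_ \<Rightarrow> 'a" and a :: "_ \<Rightarrow> 'd \<Rightarrow>\<^sub>L real"
  assume b: "sign_bounded Y b" and a: "\<forall>i\<in>I. norm (a i) \<le> 1"
  define r q where "r = norm R" and "q = norm Q"
  let ?f = "\<lambda>y. \<Sum>i\<in>I. u i y * blinfun_apply (a i) (blinfun_apply (R o\<^sub>L T o\<^sub>L Q) (b y))"
  show "\<exists>G\<subseteq>Y. real (card (Y - G)) \<le> C * e * real (card Y) \<and> (\<Sum>y\<in>G. \<bar>?f y\<bar>) \<le> C * e * real (card I)"
  proof (cases "r = 0 \<or> q = 0")
    case True
    then have "R = 0 \<or> Q = 0" by (auto simp: r_def q_def)
    then have "?f y = 0" for y by (auto simp: blinfun.zero_left blinfun.zero_right)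
    then show ?thesis using assms by (intro exI[of _ Y]) (auto simp: zero_le_mult_iff)
  next
    case False
    then have pos: "0 < r" "0 < q" by (auto simp: r_def q_def)
    define b' where "b' = (\<lambda>y. (1 / q) *\<^sub>R blinfun_apply Q (b y))"
    define a' where "a' = (\<lambda>i. (1 / r) *\<^sub>R (a i o\<^sub>L R))"
    have "sign_bounded Y b'"
      unfolding sign_bounded_def
    proof (intro allI impI)
      fix s :: "_ \<Rightarrow> real" assume "\<forall>y\<in>Y. \<bar>s y\<bar> \<le> 1"
      then have n: "norm (\<Sum>y\<in>Y. s y *\<^sub>R b y) \<le> 1" using b unfolding sign_bounded_def by blast
      have "(\<Sum>y\<in>Y. s y *\<^sub>R b' y) = (1 / q) *\<^sub>R blinfun_apply Q (\<Sum>y\<in>Y. s y *\<^sub>R b y)"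
        by (simp add: b'_def blinfun.sum_right blinfun.scaleR_right scaleR_sum_right mult.commute)
      then have "norm (\<Sum>y\<in>Y. s y *\<^sub>R b' y) = (1 / q) * norm (blinfun_apply Q (\<Sum>y\<in>Y. s y *\<^sub>R b y))"
        using pos by simp
      also have "\<dots> \<le> (1 / q) * (q * 1)"
        using pos n unfolding q_def
        by (intro mult_left_mono order_trans[OF norm_blinfun]) (auto intro: mult_left_mono)
      finally show "norm (\<Sum>y\<in>Y. s y *\<^sub>R b' y) \<le> 1" using pos by simp
    qed
    moreover have "norm (a' i) \<le> 1" if "i \<in> I" for i
    proof -
      have "norm (a i o\<^sub>L R) \<le> norm (a i) * norm R" by (rule norm_blinfun_compose)
      also have "\<dots> \<le> r" unfolding r_def using a that by (simp add: mult_left_le_one_le)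
      finally show ?thesis using pos by (simp add: a'_def)
    qed
    ultimately have "sign_bounded Y b'" "\<forall>i\<in>I. norm (a' i) \<le> 1" by blast+
    then obtain G where G: "G \<subseteq> Y" "real (card (Y - G)) \<le> e * real (card Y)"
      "(\<Sum>y\<in>G. \<bar>\<Sum>i\<in>I. u i y * blinfun_apply (a' i) (blinfun_apply T (b' y))\<bar>) \<le> e * real (card I)"
      using diagonal_smallD[OF T] by blast
    have f: "?f y = (r * q) * (\<Sum>i\<in>I. u i y * blinfun_apply (a' i) (blinfun_apply T (b' y)))" for y
      unfolding sum_distrib_left
      by (intro sum.cong refl)
        (use pos in \<open>simp add: a'_def b'_def blinfun.scaleR_left blinfun.scaleR_right\<close>)
    have rq: "r * q \<le> C" using assms(2) by (simp add: r_def q_def)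
    show ?thesis
    proof (intro exI[of _ G] conjI)
      have "e * real (card Y) \<le> C * (e * real (card Y))"
        using mult_right_mono[OF \<open>1 \<le> C\<close>, of "e * real (card Y)"] \<open>0 \<le> e\<close> by simp
      then show "real (card (Y - G)) \<le> C * e * real (card Y)" using G(2) by simp
      have "(\<Sum>y\<in>G. \<bar>?f y\<bar>)
          = (r * q) * (\<Sum>y\<in>G. \<bar>\<Sum>i\<in>I. u i y * blinfun_apply (a' i) (blinfun_apply T (b' y))\<bar>)"
        unfolding f abs_mult using pos by (simp add: sum_distrib_left)
      also have "\<dots> \<le> (r * q) * (e * real (card I))" using G(3) pos by (intro mult_left_mono) auto
      also have "\<dots> \<le> C * (e * real (card I))" using rq \<open>0 \<le> e\<close> by (intro mult_right_mono) auto
      finally show "(\<Sum>y\<in>G. \<bar>?f y\<bar>) \<le> C * e * real (card I)" by simp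
    qed (rule G(1))
  qed
qed

text \<open>
  The absolute values are realised by signs of the \<open>y\<close>, and \<open>sign_bounded\<close> controls
  \<open>\<Sum>y\<in>Y. sgn (\<dots>) * u i y *\<^sub>R b y\<close> for each \<open>i\<close>.
\<close>

lemma diagonal_small_norm:
  fixes T :: "'a::real_normed_vector \<Rightarrow>\<^sub>L 'b::real_normed_vector"
  assumes u: "\<And>i y. \<bar>u i y\<bar> \<le> 1" and "norm T \<le> e"
  shows "diagonal_small Y I u e T"
  unfolding diagonal_small_def
proof (intro allI impI)
  fix b :: "_ \<Rightarrow> 'a" and a :: "_ \<Rightarrow> 'b \<Rightarrow>\<^sub>L real"
  assume b: "sign_bounded Y b" and a: "\<forall>i\<in>I. norm (a i) \<le> 1"
  let ?f = "\<lambda>y. \<Sum>i\<in>I. u i y * blinfun_apply (a i) (blinfun_apply T (b y))"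
  have e: "0 \<le> e" using assms(2) norm_ge_zero order_trans by blast
  have "(\<Sum>y\<in>Y. \<bar>?f y\<bar>)
      = (\<Sum>y\<in>Y. \<Sum>i\<in>I. (sgn (?f y) * u i y) * blinfun_apply (a i) (blinfun_apply T (b y)))"
    by (simp add: abs_sgn sum_distrib_left sum_distrib_right mult_ac)
  also have "\<dots> = (\<Sum>i\<in>I. blinfun_apply (a i) (blinfun_apply T (\<Sum>y\<in>Y. (sgn (?f y) * u i y) *\<^sub>R b y)))"
    by (subst sum.swap) (simp add: blinfun.sum_right blinfun.scaleR_right)
  also have "\<dots> \<le> (\<Sum>i\<in>I. e)"
  proof (rule sum_mono)
    fix i assume "i \<in> I"
    let ?x = "\<Sum>y\<in>Y. (sgn (?f y) * u i y) *\<^sub>R b y"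
    have x: "norm ?x \<le> 1"
      using b u unfolding sign_bounded_def by (simp add: abs_mult sgn_if)
    have "blinfun_apply (a i) (blinfun_apply T ?x) \<le> norm (a i) * norm (blinfun_apply T ?x)"
      using norm_blinfun[of "a i" "blinfun_apply T ?x"] by simp
    also have "\<dots> \<le> 1 * (norm T * norm ?x)"
      using a \<open>i \<in> I\<close> by (intro mult_mono norm_blinfun) auto
    also have "\<dots> \<le> 1 * (e * 1)" using x e assms(2) by (intro mult_mono) auto
    finally show "blinfun_apply (a i) (blinfun_apply T ?x) \<le> e" by simp
  qed
  finally show "\<exists>G\<subseteq>Y. real (card (Y - G)) \<le> e * real (card Y) \<and> (\<Sum>y\<in>G. \<bar>?f y\<bar>) \<le> e * real (card I)"
    using e by (intro exI[of _ Y]) (auto simp: mult.commute)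
qed

section \<open>Walsh coefficient operators on bounded sequences\<close>

lemma apply_Bcontfun_bounded:
  fixes f :: "nat \<Rightarrow> 'k::real_normed_vector"
  assumes "\<And>n. norm (f n) \<le> C"
  shows "apply_bcontfun (Bcontfun f) = f"
proof -
  have "f \<in> bcontfun" using assms by (auto simp: bcontfun_def bounded_iff)
  then show ?thesis by (rule Bcontfun_inverse)
qed

definition on_sets :: "real linfty \<Rightarrow> nat set \<Rightarrow> real" where
  "on_sets x T = apply_bcontfun x (set_encode T)"

lemma abs_on_sets_le: "\<bar>on_sets x T\<bar> \<le> norm x"
  using norm_bounded[of x "set_encode T"] by (simp add: on_sets_def)

lemma bdd_on_sets [intro, simp]: "bdd (on_sets x)"
  by (rule bddI[OF abs_on_sets_le])

lemma on_sets_add: "on_sets (x + y) T = on_sets x T + on_sets y T"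
  by (simp add: on_sets_def)

lemma on_sets_scaleR: "on_sets (c *\<^sub>R x) T = c * on_sets x T"
  by (simp add: on_sets_def)

definition walsh_coeff :: "nat set \<Rightarrow> real linfty \<Rightarrow> real" where
  "walsh_coeff B x = mean (\<lambda>T. on_sets x T * walsh B T)"

lemma abs_coeff_le: "\<bar>walsh_coeff B x\<bar> \<le> norm x"
proof -
  have *: "\<bar>on_sets x T * walsh B T\<bar> \<le> norm x" for T by (simp add: abs_mult abs_on_sets_le)
  have "walsh_coeff B x \<le> mean (\<lambda>_. norm x)" "mean (\<lambda>_. - norm x) \<le> walsh_coeff B x"
    unfolding walsh_coeff_def
      using * by (auto intro!: mean_mono simp: abs_le_iff minus_le_iff simp del: mean_const)
  then show ?thesis by simp
qed

lemma coeff_add: "walsh_coeff B (x + y) = walsh_coeff B x + walsh_coeff B y"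
  by (simp add: walsh_coeff_def on_sets_add distrib_right mean_add)

lemma coeff_scaleR: "walsh_coeff B (c *\<^sub>R x) = c * walsh_coeff B x"
  by (simp add: walsh_coeff_def on_sets_scaleR mult.assoc mean_cmult)

definition coeff_op :: "(nat \<Rightarrow> nat set) \<Rightarrow> nat set \<Rightarrow> real linfty_op" where
  "coeff_op A K = Blinfun (\<lambda>x. Bcontfun (\<lambda>k. if k \<in> K then walsh_coeff (A k) x else 0))"

lemma apply_coeff_op:
  "apply_bcontfun (blinfun_apply (coeff_op A K) x) k = (if k \<in> K then walsh_coeff (A k) x else 0)"
proof -
  have *: "apply_bcontfun (Bcontfun (\<lambda>k. if k \<in> K then walsh_coeff (A k) x else 0)) =
      (\<lambda>k. if k \<in> K then walsh_coeff (A k) x else 0)" for x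
    by (rule apply_Bcontfun_bounded[of _ "norm x"]) (simp add: abs_coeff_le)
  have "bounded_linear (\<lambda>x. Bcontfun (\<lambda>k. if k \<in> K then walsh_coeff (A k) x else 0))"
    by (rule bounded_linear_intro[where K = 1])
      (auto intro!: bcontfun_eqI norm_bound simp: * coeff_add coeff_scaleR algebra_simps abs_coeff_le)
  then show ?thesis unfolding coeff_op_def by (simp add: bounded_linear_Blinfun_apply *)
qed

text \<open>
  Bessel's inequality up to the constant \<open>2\<close>. The combination \<open>h\<close> of the Walsh functions with the
  coefficients of \<open>x\<close> satisfies \<open>mean (x * h) = \<Sum>k\<in>Q. c k ^ 2\<close> and \<open>mean (h ^ 2) \<le> 2 * (\<Sum>k\<in>Q. c k ^ 2)\<close>,
  so \<open>x * h \<le> x ^ 2 + h ^ 2 / 4\<close> suffices.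
\<close>

lemma bessel_coeff:
  fixes Q :: "nat set"
  assumes "finite Q" "\<And>k. finite (A k)" "\<And>k. k \<in> Q \<Longrightarrow> A k \<notin> combos (A ` {..<k}) 1"
  shows "(\<Sum>k\<in>Q. walsh_coeff (A k) x ^ 2) \<le> 2 * norm x ^ 2"
proof -
  define c where "c = (\<lambda>k. walsh_coeff (A k) x)"
  define h where "h = (\<lambda>T. \<Sum>k\<in>Q. c k * walsh (A k) T)"
  have bh: "bdd h" unfolding h_def by auto
  have "(\<Sum>k\<in>Q. c k ^ 2) = (\<Sum>k\<in>Q. mean (\<lambda>T. c k * (on_sets x T * walsh (A k) T)))"
    by (intro sum.cong refl, subst mean_cmult) (auto simp: c_def walsh_coeff_def power2_eq_square)
  also have "\<dots> = mean (\<lambda>T. \<Sum>k\<in>Q. c k * (on_sets x T * walsh (A k) T))"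
    by (intro mean_sum[symmetric]) auto
  also have "\<dots> = mean (\<lambda>T. on_sets x T * h T)"
    by (simp add: h_def sum_distrib_left mult_ac)
  also have "\<dots> \<le> mean (\<lambda>T. norm x ^ 2 + 1 / 4 * h T ^ 2)"
  proof (rule mean_mono)
    fix T
    have "on_sets x T * h T \<le> (on_sets x T) ^ 2 + 1 / 4 * h T ^ 2"
      using sum_squares_ge_zero[of "on_sets x T - h T / 2" 0]
      by (simp add: power2_eq_square algebra_simps)
    also have "(on_sets x T) ^ 2 \<le> norm x ^ 2"
      using abs_on_sets_le[of x T] by (metis abs_ge_zero power2_abs power_mono)
    finally show "on_sets x T * h T \<le> norm x ^ 2 + 1 / 4 * h T ^ 2" by simp
  qed (use bh in auto)
  also have "\<dots> = norm x ^ 2 + 1 / 4 * mean (\<lambda>T. h T ^ (2 * 1))"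
    using bh mean_cmult[of "\<lambda>T. h T ^ 2" "1 / 4"] by (subst mean_add) auto
  also have "mean (\<lambda>T. h T ^ (2 * 1)) \<le> moment_const 1 * (\<Sum>k\<in>Q. c k ^ 2) ^ 1"
    unfolding h_def
    by (rule mean_even_power_le[of Q A 1 c]) (use assms in auto)
  finally show ?thesis by (simp add: c_def moment_const_def)
qed

text \<open>
  By Bessel's inequality the coefficient sequence vanishes at infinity. This is what lets arbitrary
  functionals on bounded sequences be replaced by finite sums of coordinates.
\<close>

lemma finite_large_coeffs:
  fixes K :: "nat set"
  assumes "\<And>k. finite (A k)" "\<And>k. k \<in> K \<Longrightarrow> A k \<notin> combos (A ` {..<k}) 1" "0 < \<eta>"
  shows "finite {k \<in> K. \<eta> \<le> \<bar>walsh_coeff (A k) x\<bar>}"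
proof (rule ccontr)
  assume inf: "infinite {k \<in> K. \<eta> \<le> \<bar>walsh_coeff (A k) x\<bar>}"
  obtain m :: nat where m: "2 * norm x ^ 2 / \<eta> ^ 2 < real m" using reals_Archimedean2 by blast
  obtain Q where Q: "finite Q" "card Q = m" "Q \<subseteq> {k \<in> K. \<eta> \<le> \<bar>walsh_coeff (A k) x\<bar>}"
    using infinite_arbitrarily_large[OF inf] by blast
  have "real m * \<eta> ^ 2 = (\<Sum>k\<in>Q. \<eta> ^ 2)" using Q by simp
  also have "\<dots> \<le> (\<Sum>k\<in>Q. walsh_coeff (A k) x ^ 2)"
  proof (rule sum_mono)
    fix k assume "k \<in> Q"
    then show "\<eta> ^ 2 \<le> walsh_coeff (A k) x ^ 2"
      using Q(3) \<open>0 < \<eta>\<close> power_mono[of \<eta> "\<bar>walsh_coeff (A k) x\<bar>" 2] by auto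
  qed
  also have "\<dots> \<le> 2 * norm x ^ 2" using Q assms by (intro bessel_coeff) auto
  finally show False using m \<open>0 < \<eta>\<close> by (simp add: field_simps)
qed

lemma sum_abs_le_1:
  assumes "sign_bounded Y b"
  shows "(\<Sum>y\<in>Y. \<bar>apply_bcontfun (b y :: real linfty) n\<bar>) \<le> 1"
proof -
  let ?x = "\<Sum>y\<in>Y. sgn (apply_bcontfun (b y) n) *\<^sub>R b y"
  have ap: "apply_bcontfun (\<Sum>y\<in>Y. s y *\<^sub>R b y) n = (\<Sum>y\<in>Y. s y * apply_bcontfun (b y) n)" for s
    by (induction Y rule: infinite_finite_induct) auto
  have "norm ?x \<le> 1" using assms unfolding sign_bounded_def by (simp add: sgn_if)
  then have "apply_bcontfun ?x n \<le> 1" using norm_bounded[of ?x n] by simp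
  then show ?thesis by (simp add: ap abs_sgn mult.commute)
qed

lemma sum_abs_coeff_le_1:
  assumes "sign_bounded Y b"
  shows "(\<Sum>y\<in>Y. \<bar>walsh_coeff B (b y)\<bar>) \<le> 1"
proof -
  let ?x = "\<Sum>y\<in>Y. sgn (walsh_coeff B (b y)) *\<^sub>R b y"
  have ap: "walsh_coeff B (\<Sum>y\<in>Y. s y *\<^sub>R b y) = (\<Sum>y\<in>Y. s y * walsh_coeff B (b y))" for s
  proof (induction Y rule: infinite_finite_induct)
    case empty
    show ?case using coeff_scaleR[of B 0 0] by simp
  next
    case (infinite Y)
    show ?case using coeff_scaleR[of B 0 0] infinite by simp
  qed (auto simp: coeff_add coeff_scaleR)
  have "norm ?x \<le> 1" using assms unfolding sign_bounded_def by (simp add: sgn_if)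
  then have "walsh_coeff B ?x \<le> 1" using abs_coeff_le[of B ?x] by simp
  then show ?thesis by (simp add: ap abs_sgn mult.commute)
qed

definition unit_seq :: "nat \<Rightarrow> real linfty" where
  "unit_seq k = Bcontfun (\<lambda>n. of_bool (n = k))"

lemma apply_unit_seq [simp]: "apply_bcontfun (unit_seq k) n = of_bool (n = k)"
  by (simp add: unit_seq_def apply_Bcontfun_bounded[of _ 1])

lemma apply_sum_unit_seq:
  assumes "finite F"
  shows "apply_bcontfun (\<Sum>k\<in>F. c k *\<^sub>R unit_seq k) n = of_bool (n \<in> F) * c n"
  using assms by (induction F rule: finite_induct) auto

lemma sum_abs_functional_unit_seq_le_1:
  fixes a :: "real linfty \<Rightarrow>\<^sub>L real"
  assumes "finite F" "norm a \<le> 1"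
  shows "(\<Sum>k\<in>F. \<bar>blinfun_apply a (unit_seq k)\<bar>) \<le> 1"
proof -
  let ?x = "\<Sum>k\<in>F. sgn (blinfun_apply a (unit_seq k)) *\<^sub>R unit_seq k"
  have "norm ?x \<le> 1" by (rule norm_bound) (simp add: apply_sum_unit_seq assms sgn_if)
  then have "blinfun_apply a ?x \<le> 1"
    using norm_blinfun[of a ?x] mult_mono[OF assms(2) \<open>norm ?x \<le> 1\<close>] by simp
  then show ?thesis by (simp add: blinfun.sum_right blinfun.scaleR_right abs_sgn mult.commute)
qed

lemma functional_truncation:
  fixes a :: "real linfty \<Rightarrow>\<^sub>L real"
  assumes "finite F" "norm a \<le> 1" "\<And>k. k \<notin> F \<Longrightarrow> \<bar>apply_bcontfun v k\<bar> \<le> \<eta>" "0 \<le> \<eta>"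
  shows "\<bar>blinfun_apply a v - (\<Sum>k\<in>F. apply_bcontfun v k * blinfun_apply a (unit_seq k))\<bar> \<le> \<eta>"
proof -
  let ?w = "v - (\<Sum>k\<in>F. apply_bcontfun v k *\<^sub>R unit_seq k)"
  have "norm ?w \<le> \<eta>" by (rule norm_bound) (use assms in \<open>simp add: apply_sum_unit_seq\<close>)
  then have "\<bar>blinfun_apply a ?w\<bar> \<le> 1 * \<eta>"
    using norm_blinfun[of a ?w] mult_mono[OF assms(2) \<open>norm ?w \<le> \<eta>\<close>] by simp
  then show ?thesis by (simp add: blinfun.diff_right blinfun.sum_right blinfun.scaleR_right)
qed

text \<open>
  This bounds a maximum of many functions by a constant plus a sum of high powers, hence its
  mean by moments.
\<close>

lemma abs_le_truncated_power:
  fixes h L :: real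
  assumes "0 < L" "1 \<le> s"
  shows "\<bar>h\<bar> \<le> L + h ^ (2 * s) / L ^ (2 * s - 1)"
proof (cases "\<bar>h\<bar> \<le> L")
  case True
  have "0 \<le> h ^ (2 * s) / L ^ (2 * s - 1)" using assms by simp
  with True show ?thesis by linarith
next
  case False
  have "\<bar>h\<bar> * L ^ (2 * s - 1) \<le> \<bar>h\<bar> * \<bar>h\<bar> ^ (2 * s - 1)"
    using False assms by (intro mult_left_mono power_mono) auto
  also have "\<dots> = \<bar>h\<bar> ^ (2 * s)" using assms by (simp flip: power_Suc)
  also have "\<dots> = h ^ (2 * s)" by (simp add: power_even_abs)
  finally have "\<bar>h\<bar> \<le> h ^ (2 * s) / L ^ (2 * s - 1)" using assms by (simp add: field_simps)
  then show ?thesis using assms by linarith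
qed

text \<open>
  Distinct Walsh functions are orthogonal on \<open>Pow X\<close>.
\<close>

lemma sum_Pow_walsh_combination_square:
  assumes "finite X" "finite I" "inj_on A I" "\<And>i. i \<in> I \<Longrightarrow> A i \<subseteq> X"
  shows "(\<Sum>y\<in>Pow X. (\<Sum>i\<in>I. walsh (A i) y * \<alpha> i) ^ 2) = 2 ^ card X * (\<Sum>i\<in>I. \<alpha> i ^ 2)"
proof -
  have fin: "finite (A i)" if "i \<in> I" for i using assms that finite_subset by blast
  have orth: "(\<Sum>y\<in>Pow X. walsh (A i) y * walsh (A j) y) = (if j = i then 2 ^ card X else 0)"
    if "i \<in> I" "j \<in> I" for i j
  proof (cases "j = i")
    case True
    then show ?thesis using assms by (simp add: card_Pow)
  next
    case False
    then have "A i \<noteq> A j" using inj_onD[OF assms(3), of i j] that by blast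
    then have "sym_diff (A i) (A j) \<inter> X \<noteq> {}" using assms(4) that by blast
    then have "(\<Sum>y\<in>Pow X. walsh (sym_diff (A i) (A j)) y) = 0"
      using assms fin that by (intro sum_Pow_walsh) auto
    then show ?thesis using False fin that by (simp add: walsh_sym_diff)
  qed
  have "(\<Sum>y\<in>Pow X. (\<Sum>i\<in>I. walsh (A i) y * \<alpha> i) ^ 2)
      = (\<Sum>y\<in>Pow X. \<Sum>i\<in>I. \<Sum>j\<in>I. (\<alpha> i * \<alpha> j) * (walsh (A i) y * walsh (A j) y))"
    by (simp add: power2_eq_square sum_product mult_ac)
  also have "\<dots> = (\<Sum>i\<in>I. \<Sum>j\<in>I. (\<alpha> i * \<alpha> j) * (\<Sum>y\<in>Pow X. walsh (A i) y * walsh (A j) y))"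
    by (subst sum.swap, intro sum.cong refl, subst sum.swap) (simp add: sum_distrib_left)
  also have "\<dots> = (\<Sum>i\<in>I. \<Sum>j\<in>I. if j = i then (\<alpha> i * \<alpha> j) * 2 ^ card X else 0)"
    by (intro sum.cong refl) (simp add: orth)
  also have "\<dots> = 2 ^ card X * (\<Sum>i\<in>I. \<alpha> i ^ 2)"
    using assms by (simp add: sum_distrib_left power2_eq_square mult_ac)
  finally show ?thesis .
qed

section \<open>Blocks of independent Walsh functions\<close>

text \<open>
  Block \<open>n\<close> consists of the indices \<open>k\<close> with \<open>\<kappa> n \<le> k < \<kappa> (Suc n)\<close>; its Walsh functions live on the
  \<open>2 ^ \<l> n\<close> points of \<open>Pow {..<\<l> n}\<close>. Writing \<open>N\<close> for the block length, \<open>past\<close> says that all earlier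
  blocks together have fewer than about \<open>sqrt N\<close> indices, and \<open>few_points\<close> that the number of points is much
  smaller than \<open>N ^ s n\<close>. By \<open>A_indep\<close>, the Walsh functions of all later blocks satisfy Khintchine's
  inequality with exponent \<open>2 * s n\<close>. Block \<open>n\<close> itself cannot do so with a useful constant: the sum of its
  functions, with signs chosen at one point, has the value \<open>N\<close> there.
\<close>

locale independent_blocks =
  fixes A :: "nat \<Rightarrow> nat set" and \<kappa> \<l> s :: "nat \<Rightarrow> nat"
  assumes fin_A: "\<And>k. finite (A k)"
    and \<kappa>_less: "\<And>n. \<kappa> n < \<kappa> (Suc n)"
    and A_sub: "\<And>n k. \<kappa> n \<le> k \<Longrightarrow> k < \<kappa> (Suc n) \<Longrightarrow> A k \<subseteq> {..<\<l> n}"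
    and A_indep1: "\<And>k. A k \<notin> combos (A ` {..<k}) 1"
    and A_indep: "\<And>n k. \<kappa> (Suc n) \<le> k \<Longrightarrow> A k \<notin> combos (A ` {..<k}) (2 * s n - 1)"
    and s_pos: "\<And>n. 1 \<le> s n"
    and past: "\<And>n. (n + 1) * \<kappa> n ^ 2 \<le> \<kappa> (Suc n) - \<kappa> n"
    and few_points: "\<And>n. 2 ^ \<l> n * moment_const (s n) * real (n + 1) ^ s n
        \<le> real (\<kappa> (Suc n) - \<kappa> n) ^ s n"
begin

definition points :: "nat \<Rightarrow> nat set set" where
  "points n = Pow {..<\<l> n}"

definition block :: "nat \<Rightarrow> nat set" where
  "block n = {\<kappa> n..<\<kappa> (Suc n)}"

abbreviation small :: "nat \<Rightarrow> real \<Rightarrow> ('a::real_normed_vector \<Rightarrow>\<^sub>L 'b::real_normed_vector) \<Rightarrow> bool" where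
  "small n \<equiv> diagonal_small (points n) (block n) (\<lambda>i. walsh (A i))"

abbreviation block_op :: "nat set \<Rightarrow> real linfty_op" where
  "block_op S \<equiv> coeff_op A (\<Union>m\<in>S. block m)"

lemma finite_points [simp]: "finite (points n)" and card_points: "card (points n) = 2 ^ \<l> n"
  by (simp_all add: points_def card_Pow)

lemma finite_block [simp]: "finite (block n)" and card_block_pos: "0 < card (block n)"
  using \<kappa>_less[of n] by (simp_all add: block_def)

lemma inj_A: "inj A"
proof (rule injI)
  have ne: "A j \<noteq> A k" if "j < k" for j k
  proof
    assume "A j = A k"
    then have "A k \<in> sym_diff (A j) ` combos (A ` {..<k}) 0" by simp
    then have "A k \<in> combos (A ` {..<k}) 1" using that by auto
    then show False using A_indep1 by blast
  qed
  fix j k assume "A j = A k"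
  then show "j = k" using ne[of j k] ne[of k j] by (cases j k rule: linorder_cases) auto
qed

lemma outside_block:
  assumes "k \<in> (\<Union>m\<in>S. block m)" "n \<notin> S"
  shows "k < \<kappa> n \<or> \<kappa> (Suc n) \<le> k"
proof -
  obtain m where m: "m \<in> S" "\<kappa> m \<le> k" "k < \<kappa> (Suc m)" using assms by (auto simp: block_def)
  have mono: "i \<le> j \<Longrightarrow> \<kappa> i \<le> \<kappa> j" for i j
    by (rule lift_Suc_mono_le[of \<kappa>]) (simp_all add: \<kappa>_less less_imp_le)
  have "m < n \<or> n < m" using m(1) assms(2) by (metis linorder_neqE_nat)
  then show ?thesis using mono[of "Suc m" n] mono[of "Suc n" m] m by auto
qed

text \<open>
  The heart of the separation: an operator built from blocks other than \<open>n\<close> fails to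
  reproduce the matrix of block \<open>n\<close>. Up to a small error every \<open>a i\<close> acts on the images \<open>v\<close> as a finite sum
  \<open>\<Sum>k\<in>F. \<alpha> i k * v k\<close> with \<open>\<Sum>k\<in>F. \<bar>\<alpha> i k\<bar> \<le> 1\<close>, so everything is governed by the vectors
  \<open>z y = (\<Sum>i\<in>I. walsh (A i) y * \<alpha> i k)\<^sub>k\<close>. By orthogonality their squared Euclidean norms are at most \<open>N\<close>
  on average over \<open>y\<close>, hence at most \<open>N / e\<close> outside a fraction \<open>e\<close> of the points. Earlier indices
  contribute at most \<open>\<kappa> n * sqrt (N / e)\<close>. Later ones contribute at most the mean of
  \<open>max\<^sub>y \<bar>\<Sum>k. z y k * walsh (A k) T\<bar>\<close>; a maximum over \<open>M\<close> functions costs a factor \<open>M ^ (1 / 2p)\<close> over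
  their moment of order \<open>2p\<close>, so it has size about \<open>M ^ (1 / 2p) * sqrt (N / e)\<close>, which is small
  compared with \<open>N\<close> when \<open>M\<close> is small compared with \<open>N ^ p\<close>.
\<close>

lemma small_block_op:
  assumes "n \<notin> S" "0 < e" "1 / real (n + 1) \<le> e ^ 3"
  shows "small n (4 * e) (block_op S)"
  unfolding diagonal_small_def
proof (intro allI impI)
  fix b :: "nat set \<Rightarrow> real linfty" and a :: "nat \<Rightarrow> real linfty \<Rightarrow>\<^sub>L real"
  assume b: "sign_bounded (points n) b" and a: "\<forall>i\<in>block n. norm (a i) \<le> 1"
  define Y I N K where "Y = points n" and "I = block n" and "N = real (card (block n))"
    and "K = (\<Union>m\<in>S. block m)"
  define V where "V = blinfun_apply (coeff_op A K)"
  \<comment> \<open>Coefficients below \<open>\<eta>\<close> cost \<open>N * \<eta>\<close> for each point, so \<open>e * N\<close> in total.\<close>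
  define \<eta> where "\<eta> = e / real (card Y)"
  define F where "F = (\<Union>y\<in>Y. {k \<in> K. \<eta> \<le> \<bar>walsh_coeff (A k) (b y)\<bar>})"
  define c where "c = (\<lambda>y k. walsh_coeff (A k) (b y))"
  define \<alpha> where "\<alpha> = (\<lambda>i k. blinfun_apply (a i) (unit_seq k))"
  define z where "z = (\<lambda>y k. \<Sum>i\<in>I. walsh (A i) y * \<alpha> i k)"
  define G where "G = {y \<in> Y. (\<Sum>k\<in>F. z y k ^ 2) \<le> N / e}"
  have N: "0 < N" using card_block_pos by (simp add: N_def)
  have fY [simp]: "finite Y" and cY: "0 < real (card Y)" by (simp_all add: Y_def card_points)
  have \<eta>: "0 < \<eta>" using \<open>0 < e\<close> cY by (simp add: \<eta>_def)
  have fG [simp]: "finite G" and GY: "G \<subseteq> Y" by (auto simp: G_def)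
  have fF: "finite F"
    unfolding F_def using \<eta> by (intro finite_UN_I finite_large_coeffs fin_A A_indep1) simp
  have FK: "F \<subseteq> K" by (auto simp: F_def)
  have growth: "1 \<le> real (n + 1) * e ^ 3" using assms(3) by (simp add: field_simps)
  have N_eq: "N = real (\<kappa> (Suc n) - \<kappa> n)" by (simp add: N_def block_def)
  have \<alpha>: "(\<Sum>k\<in>F. \<bar>\<alpha> i k\<bar>) \<le> 1" if "i \<in> I" for i
    unfolding \<alpha>_def using a that fF by (intro sum_abs_functional_unit_seq_le_1) (auto simp: I_def)

  \<comment> \<open>Chebyshev's inequality for the uniform distribution of \<open>y\<close>.\<close>
  have card_bad: "real (card (Y - G)) \<le> e * real (card Y)"
  proof -
    have "(\<Sum>y\<in>Y. \<Sum>k\<in>F. z y k ^ 2) = (\<Sum>k\<in>F. \<Sum>y\<in>Y. z y k ^ 2)" by (rule sum.swap)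
    also have "\<dots> = (\<Sum>k\<in>F. 2 ^ \<l> n * (\<Sum>i\<in>I. \<alpha> i k ^ 2))"
      unfolding z_def Y_def points_def
      using sum_Pow_walsh_combination_square[of "{..<\<l> n}" I A] inj_A A_sub
      by (intro sum.cong refl) (auto simp: I_def block_def inj_on_subset)
    also have "\<dots> = card Y * (\<Sum>i\<in>I. \<Sum>k\<in>F. \<alpha> i k ^ 2)"
      by (simp add: Y_def card_points sum_distrib_left sum.swap[of _ I F])
    also have "(\<Sum>i\<in>I. \<Sum>k\<in>F. \<alpha> i k ^ 2) \<le> (\<Sum>i\<in>I. 1)"
    proof (rule sum_mono)
      fix i assume i: "i \<in> I"
      have "\<bar>\<alpha> i k\<bar> \<le> 1" if "k \<in> F" for k
        using member_le_sum[of k F "\<lambda>k. \<bar>\<alpha> i k\<bar>"] \<alpha>[OF i] fF that by simp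
      then have "(\<Sum>k\<in>F. \<alpha> i k ^ 2) \<le> (\<Sum>k\<in>F. \<bar>\<alpha> i k\<bar>)"
        by (intro sum_mono) (metis abs_ge_zero mult_left_le power2_abs power2_eq_square)
      with \<alpha>[OF i] show "(\<Sum>k\<in>F. \<alpha> i k ^ 2) \<le> 1" by simp
    qed
    finally have total: "(\<Sum>y\<in>Y. \<Sum>k\<in>F. z y k ^ 2) \<le> card Y * N"
      using cY by (simp add: N_def I_def)
    have "card (Y - G) * (N / e) = (\<Sum>y\<in>Y - G. N / e)" by simp
    also have "\<dots> \<le> (\<Sum>y\<in>Y - G. \<Sum>k\<in>F. z y k ^ 2)" by (intro sum_mono) (auto simp: G_def)
    also have "\<dots> \<le> (\<Sum>y\<in>Y. \<Sum>k\<in>F. z y k ^ 2)" by (intro sum_mono2) (auto intro: sum_nonneg)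
    finally have "card (Y - G) * (N / e) \<le> card Y * N" using total by linarith
    then show ?thesis using N \<open>0 < e\<close> by (simp add: field_simps)
  qed

  have truncate: "\<bar>\<Sum>i\<in>I. walsh (A i) y * blinfun_apply (a i) (V (b y))\<bar>
      \<le> \<bar>\<Sum>k\<in>F. c y k * z y k\<bar> + N * \<eta>" if "y \<in> Y" for y
  proof -
    let ?r = "\<lambda>i. blinfun_apply (a i) (V (b y)) - (\<Sum>k\<in>F. c y k * \<alpha> i k)"
    have cV: "apply_bcontfun (V (b y)) k = c y k" if "k \<in> F" for k
      using that FK by (auto simp: V_def apply_coeff_op c_def)
    have r: "\<bar>?r i\<bar> \<le> \<eta>" if "i \<in> I" for i
    proof -
      have "\<bar>blinfun_apply (a i) (V (b y)) - (\<Sum>k\<in>F. apply_bcontfun (V (b y)) k * blinfun_apply (a i) (unit_seq k))\<bar> \<le> \<eta>"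
      proof (rule functional_truncation[OF fF])
        show "norm (a i) \<le> 1" using a that by (simp add: I_def)
        show "\<bar>apply_bcontfun (V (b y)) k\<bar> \<le> \<eta>" if "k \<notin> F" for k
          using that \<open>y \<in> Y\<close> \<eta> by (auto simp: V_def apply_coeff_op F_def not_le)
      qed (use \<eta> in simp)
      then show ?thesis by (simp add: cV \<alpha>_def cong: sum.cong)
    qed
    have "(\<Sum>i\<in>I. walsh (A i) y * blinfun_apply (a i) (V (b y)))
        = (\<Sum>i\<in>I. walsh (A i) y * (\<Sum>k\<in>F. c y k * \<alpha> i k)) + (\<Sum>i\<in>I. walsh (A i) y * ?r i)"
      by (simp add: algebra_simps flip: sum.distrib)
    also have "(\<Sum>i\<in>I. walsh (A i) y * (\<Sum>k\<in>F. c y k * \<alpha> i k)) = (\<Sum>k\<in>F. c y k * z y k)"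
      unfolding z_def sum_distrib_left by (subst sum.swap) (simp add: mult_ac)
    finally have "\<bar>\<Sum>i\<in>I. walsh (A i) y * blinfun_apply (a i) (V (b y))\<bar>
        \<le> \<bar>\<Sum>k\<in>F. c y k * z y k\<bar> + \<bar>\<Sum>i\<in>I. walsh (A i) y * ?r i\<bar>" by linarith
    also have "\<bar>\<Sum>i\<in>I. walsh (A i) y * ?r i\<bar> \<le> (\<Sum>i\<in>I. \<bar>walsh (A i) y * ?r i\<bar>)" by (rule sum_abs)
    also have "\<dots> \<le> (\<Sum>i\<in>I. \<eta>)" using r by (intro sum_mono) (simp add: abs_mult)
    also have "\<dots> = N * \<eta>" by (simp add: N_def I_def)
    finally show ?thesis by simp
  qed

  have early: "(\<Sum>y\<in>G. \<bar>\<Sum>k\<in>F \<inter> {..<\<kappa> n}. c y k * z y k\<bar>) \<le> e * N"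
  proof -
    have zG: "\<bar>z y k\<bar> \<le> sqrt (N / e)" if "y \<in> G" "k \<in> F" for y k
    proof (rule real_le_rsqrt)
      have "z y k ^ 2 \<le> (\<Sum>k\<in>F. z y k ^ 2)" using that fF by (intro member_le_sum) auto
      with that show "\<bar>z y k\<bar> ^ 2 \<le> N / e" by (simp add: G_def)
    qed
    have "(\<Sum>y\<in>G. \<bar>\<Sum>k\<in>F \<inter> {..<\<kappa> n}. c y k * z y k\<bar>)
        \<le> (\<Sum>y\<in>G. \<Sum>k\<in>F \<inter> {..<\<kappa> n}. \<bar>c y k\<bar> * sqrt (N / e))"
    proof (rule sum_mono)
      fix y assume "y \<in> G"
      have "\<bar>\<Sum>k\<in>F \<inter> {..<\<kappa> n}. c y k * z y k\<bar> \<le> (\<Sum>k\<in>F \<inter> {..<\<kappa> n}. \<bar>c y k * z y k\<bar>)" by (rule sum_abs)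
      also have "\<dots> \<le> (\<Sum>k\<in>F \<inter> {..<\<kappa> n}. \<bar>c y k\<bar> * sqrt (N / e))"
        using zG \<open>y \<in> G\<close> unfolding abs_mult by (intro sum_mono mult_left_mono) auto
      finally show "\<bar>\<Sum>k\<in>F \<inter> {..<\<kappa> n}. c y k * z y k\<bar> \<le> (\<Sum>k\<in>F \<inter> {..<\<kappa> n}. \<bar>c y k\<bar> * sqrt (N / e))" .
    qed
    also have "\<dots> = (\<Sum>k\<in>F \<inter> {..<\<kappa> n}. (\<Sum>y\<in>G. \<bar>c y k\<bar>) * sqrt (N / e))"
      by (subst sum.swap) (simp add: sum_distrib_right)
    also have "\<dots> \<le> (\<Sum>k\<in>F \<inter> {..<\<kappa> n}. 1 * sqrt (N / e))"
    proof (intro sum_mono mult_right_mono)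
      fix k
      have "(\<Sum>y\<in>G. \<bar>c y k\<bar>) \<le> (\<Sum>y\<in>Y. \<bar>c y k\<bar>)" using GY by (intro sum_mono2) auto
      also have "\<dots> \<le> 1" unfolding c_def Y_def by (rule sum_abs_coeff_le_1[OF b])
      finally show "(\<Sum>y\<in>G. \<bar>c y k\<bar>) \<le> 1" .
    qed (use N \<open>0 < e\<close> in auto)
    also have "\<dots> \<le> real (\<kappa> n) * sqrt (N / e)"
      using card_mono[of "{..<\<kappa> n}" "F \<inter> {..<\<kappa> n}"] N \<open>0 < e\<close> by (auto intro!: mult_right_mono)
    also have "\<dots> \<le> e * N"
    proof (rule power2_le_imp_le)
      have "real ((n + 1) * \<kappa> n ^ 2) \<le> N" unfolding N_eq of_nat_le_iff by (rule past)
      then have p: "real (n + 1) * (real (\<kappa> n)) ^ 2 \<le> N" by (simp add: algebra_simps)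
      have "(real (\<kappa> n)) ^ 2 * 1 \<le> (real (\<kappa> n)) ^ 2 * (real (n + 1) * e ^ 3)"
        using growth by (rule mult_left_mono) simp
      also have "\<dots> = e ^ 3 * (real (n + 1) * (real (\<kappa> n)) ^ 2)" by (simp only: mult_ac)
      also have "\<dots> \<le> e ^ 3 * N" using p \<open>0 < e\<close> by (intro mult_left_mono) auto
      finally have "(real (\<kappa> n)) ^ 2 * (N / e) \<le> e ^ 3 * N * (N / e)"
        using N \<open>0 < e\<close> by (intro mult_right_mono) auto
      also have "\<dots> = (e * N) ^ 2" using \<open>0 < e\<close> by (simp add: power2_eq_square power3_eq_cube)
      finally show "(real (\<kappa> n) * sqrt (N / e)) ^ 2 \<le> (e * N) ^ 2"
        using N \<open>0 < e\<close> by (simp add: power_mult_distrib)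
    qed (use N \<open>0 < e\<close> in auto)
    finally show ?thesis .
  qed

  define H where "H = F \<inter> {\<kappa> (Suc n)..}"
  have late: "(\<Sum>y\<in>G. \<bar>\<Sum>k\<in>H. c y k * z y k\<bar>) \<le> 2 * (e * N)"
  proof -
    define L where "L = e * N"
    define p where "p = s n"
    define h where "h = (\<lambda>y T. \<Sum>k\<in>H. z y k * walsh (A k) T)"
    define \<sigma> where "\<sigma> = (\<lambda>y. sgn (\<Sum>k\<in>H. c y k * z y k))"
    have L: "0 < L" using N \<open>0 < e\<close> by (simp add: L_def)
    have bh [simp]: "bdd (h y)" for y unfolding h_def by auto
    have fH: "finite H" using fF by (simp add: H_def)
    have moment: "mean (\<lambda>T. h y T ^ (2 * p)) \<le> moment_const p * (N / e) ^ p" if "y \<in> G" for y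
    proof -
      have "mean (\<lambda>T. h y T ^ (2 * p)) \<le> moment_const p * (\<Sum>k\<in>H. z y k ^ 2) ^ p"
        unfolding h_def p_def
          using fH fin_A A_indep by (intro mean_even_power_le) (auto simp: H_def)
      also have "\<dots> \<le> moment_const p * (N / e) ^ p"
      proof (intro mult_left_mono power_mono)
        have "(\<Sum>k\<in>H. z y k ^ 2) \<le> (\<Sum>k\<in>F. z y k ^ 2)"
          using fF by (intro sum_mono2) (auto simp: H_def)
        also have "\<dots> \<le> N / e" using that by (simp add: G_def)
        finally show "(\<Sum>k\<in>H. z y k ^ 2) \<le> N / e" .
      qed (auto simp: moment_const_def intro: sum_nonneg)
      finally show ?thesis .
    qed
    \<comment> \<open>The signs \<open>\<sigma> y\<close> turn the sum into one mean, of \<open>\<Sum>y. \<sigma> y * b y * h y\<close>. At each point \<open>T\<close> this is at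
      most the maximum of the \<open>\<bar>h y T\<bar>\<close>, because \<open>\<Sum>y. \<bar>b y T\<bar> \<le> 1\<close>.\<close>
    have "(\<Sum>y\<in>G. \<bar>\<Sum>k\<in>H. c y k * z y k\<bar>) = (\<Sum>y\<in>G. \<Sum>k\<in>H. \<sigma> y * z y k * c y k)"
      by (simp add: \<sigma>_def abs_sgn sum_distrib_right sum_distrib_left mult_ac)
    also have "\<dots> = (\<Sum>y\<in>G. \<Sum>k\<in>H. mean (\<lambda>T. \<sigma> y * z y k * (on_sets (b y) T * walsh (A k) T)))"
      by (intro sum.cong refl, subst mean_cmult) (auto simp: c_def walsh_coeff_def)
    also have "\<dots> = (\<Sum>y\<in>G. mean (\<lambda>T. \<Sum>k\<in>H. \<sigma> y * z y k * (on_sets (b y) T * walsh (A k) T)))"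
      by (intro sum.cong refl mean_sum[symmetric]) auto
    also have "\<dots> = (\<Sum>y\<in>G. mean (\<lambda>T. \<sigma> y * (on_sets (b y) T * h y T)))"
      by (simp add: h_def sum_distrib_left mult_ac)
    also have "\<dots> = mean (\<lambda>T. \<Sum>y\<in>G. \<sigma> y * (on_sets (b y) T * h y T))"
      by (intro mean_sum[symmetric]) auto
    also have "\<dots> \<le> mean (\<lambda>T. L + (\<Sum>y\<in>G. h y T ^ (2 * p)) / L ^ (2 * p - 1))"
    proof (rule mean_mono)
      fix T
      have b1: "(\<Sum>y\<in>G. \<bar>on_sets (b y) T\<bar>) \<le> 1"
      proof -
        have "(\<Sum>y\<in>G. \<bar>on_sets (b y) T\<bar>) \<le> (\<Sum>y\<in>Y. \<bar>on_sets (b y) T\<bar>)"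
          using GY by (intro sum_mono2) auto
        also have "\<dots> \<le> 1" unfolding on_sets_def Y_def by (rule sum_abs_le_1[OF b])
        finally show ?thesis .
      qed
      have by1: "\<bar>on_sets (b y) T\<bar> \<le> 1" if "y \<in> G" for y
        using member_le_sum[of y G "\<lambda>y. \<bar>on_sets (b y) T\<bar>"] that b1 by simp
      have "(\<Sum>y\<in>G. \<sigma> y * (on_sets (b y) T * h y T))
          \<le> (\<Sum>y\<in>G. \<bar>on_sets (b y) T\<bar> * L + h y T ^ (2 * p) / L ^ (2 * p - 1))"
      proof (rule sum_mono)
        fix y assume y: "y \<in> G"
        have "\<bar>\<sigma> y\<bar> \<le> 1" by (simp add: \<sigma>_def sgn_if)
        have "\<sigma> y * (on_sets (b y) T * h y T) \<le> \<bar>\<sigma> y\<bar> * (\<bar>on_sets (b y) T\<bar> * \<bar>h y T\<bar>)"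
          by (metis abs_ge_self abs_mult)
        also have "\<dots> \<le> 1 * (\<bar>on_sets (b y) T\<bar> * \<bar>h y T\<bar>)"
          using \<open>\<bar>\<sigma> y\<bar> \<le> 1\<close> by (intro mult_right_mono) auto
        also have "\<dots> \<le> 1 * (\<bar>on_sets (b y) T\<bar> * (L + h y T ^ (2 * p) / L ^ (2 * p - 1)))"
          using abs_le_truncated_power[of L p "h y T"] L s_pos[of n]
          by (intro mult_left_mono) (auto simp: p_def)
        also have "\<dots>
            = \<bar>on_sets (b y) T\<bar> * L + \<bar>on_sets (b y) T\<bar> * (h y T ^ (2 * p) / L ^ (2 * p - 1))"
          by (simp add: distrib_left)
        also have "\<dots> \<le> \<bar>on_sets (b y) T\<bar> * L + 1 * (h y T ^ (2 * p) / L ^ (2 * p - 1))"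
          using by1[OF y] L by (intro add_left_mono mult_right_mono) auto
        finally show "\<sigma> y * (on_sets (b y) T * h y T)
          \<le> \<bar>on_sets (b y) T\<bar> * L + h y T ^ (2 * p) / L ^ (2 * p - 1)" by simp
      qed
      also have "\<dots> = (\<Sum>y\<in>G. \<bar>on_sets (b y) T\<bar>) * L + (\<Sum>y\<in>G. h y T ^ (2 * p)) / L ^ (2 * p - 1)"
        by (simp add: sum.distrib sum_distrib_right sum_divide_distrib)
      also have "\<dots> \<le> 1 * L + (\<Sum>y\<in>G. h y T ^ (2 * p)) / L ^ (2 * p - 1)"
        using b1 L by (intro add_right_mono mult_right_mono) auto
      finally show "(\<Sum>y\<in>G. \<sigma> y * (on_sets (b y) T * h y T))
          \<le> L + (\<Sum>y\<in>G. h y T ^ (2 * p)) / L ^ (2 * p - 1)" by simp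
    qed auto
    also have "\<dots> = L + mean (\<lambda>T. 1 / L ^ (2 * p - 1) * (\<Sum>y\<in>G. h y T ^ (2 * p)))"
      by (subst mean_add) auto
    also have "\<dots> = L + 1 / L ^ (2 * p - 1) * (\<Sum>y\<in>G. mean (\<lambda>T. h y T ^ (2 * p)))"
      by (subst mean_cmult, simp, subst mean_sum) auto
    also have "\<dots> \<le> L + 1 / L ^ (2 * p - 1) * (\<Sum>y\<in>Y. moment_const p * (N / e) ^ p)"
    proof -
      have "(\<Sum>y\<in>G. mean (\<lambda>T. h y T ^ (2 * p))) \<le> (\<Sum>y\<in>G. moment_const p * (N / e) ^ p)"
        using moment by (rule sum_mono)
      also have "\<dots> \<le> (\<Sum>y\<in>Y. moment_const p * (N / e) ^ p)"
        using GY N \<open>0 < e\<close> by (intro sum_mono2) (auto simp: moment_const_def)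
      finally show ?thesis using L by (intro add_left_mono mult_left_mono) auto
    qed
    also have "\<dots> \<le> L + 1 / L ^ (2 * p - 1) * L ^ (2 * p)"
    proof -
      have "2 ^ \<l> n * moment_const p * 1 \<le> 2 ^ \<l> n * moment_const p * (real (n + 1) * e ^ 3) ^ p"
        using growth by (intro mult_left_mono one_le_power) (auto simp: moment_const_def)
      also have "\<dots> = (2 ^ \<l> n * moment_const p * real (n + 1) ^ p) * (e ^ 3) ^ p"
        by (simp only: power_mult_distrib mult_ac)
      also have "\<dots> \<le> N ^ p * (e ^ 3) ^ p"
        using few_points[of n] \<open>0 < e\<close> unfolding N_eq p_def by (intro mult_right_mono) auto
      finally have "2 ^ \<l> n * moment_const p * (N / e) ^ p \<le> N ^ p * (e ^ 3) ^ p * (N / e) ^ p"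
        using N \<open>0 < e\<close> by (intro mult_right_mono) auto
      also have "\<dots> = (N * e ^ 3 * (N / e)) ^ p" by (simp only: power_mult_distrib)
      also have "N * e ^ 3 * (N / e) = L ^ 2"
        using \<open>0 < e\<close> by (simp add: L_def power2_eq_square power3_eq_cube)
      also have "(L ^ 2) ^ p = L ^ (2 * p)" by (simp add: power_mult)
      finally show ?thesis using L
        by (intro add_left_mono mult_left_mono) (auto simp: Y_def card_points)
    qed
    also have "\<dots> = 2 * L"
    proof -
      have "L ^ (2 * p) = L ^ (2 * p - 1) * L"
        using s_pos[of n] by (simp add: p_def flip: power_Suc2)
      then show ?thesis using L by simp
    qed
    finally show ?thesis by (simp add: L_def)
  qed

  have "(\<Sum>y\<in>G. \<bar>\<Sum>i\<in>I. walsh (A i) y * blinfun_apply (a i) (V (b y))\<bar>)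
      \<le> (\<Sum>y\<in>G. \<bar>\<Sum>k\<in>F \<inter> {..<\<kappa> n}. c y k * z y k\<bar> + \<bar>\<Sum>k\<in>H. c y k * z y k\<bar> + N * \<eta>)"
  proof (rule sum_mono)
    fix y assume "y \<in> G"
    have "F = (F \<inter> {..<\<kappa> n}) \<union> H"
      unfolding H_def using FK outside_block[OF _ assms(1)] by (fastforce simp: K_def)
    moreover have "(F \<inter> {..<\<kappa> n}) \<inter> H = {}" using \<kappa>_less[of n] by (auto simp: H_def)
    ultimately have "(\<Sum>k\<in>F. c y k * z y k)
        = (\<Sum>k\<in>F \<inter> {..<\<kappa> n}. c y k * z y k) + (\<Sum>k\<in>H. c y k * z y k)"
      using fF by (metis finite_Un sum.union_disjoint)
    then show "\<bar>\<Sum>i\<in>I. walsh (A i) y * blinfun_apply (a i) (V (b y))\<bar>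
        \<le> \<bar>\<Sum>k\<in>F \<inter> {..<\<kappa> n}. c y k * z y k\<bar> + \<bar>\<Sum>k\<in>H. c y k * z y k\<bar> + N * \<eta>"
      using truncate[of y] \<open>y \<in> G\<close> GY by auto
  qed
  also have "\<dots> \<le> e * N + 2 * (e * N) + card G * (N * \<eta>)"
    using add_mono[OF early late] by (simp add: sum.distrib)
  also have "card G * (N * \<eta>) \<le> card Y * (N * \<eta>)"
    using GY N \<eta> by (intro mult_right_mono) (auto intro: card_mono)
  also have "card Y * (N * \<eta>) = e * N" using cY by (auto simp: \<eta>_def)
  finally have sum_le: "(\<Sum>y\<in>G. \<bar>\<Sum>i\<in>I. walsh (A i) y * blinfun_apply (a i) (V (b y))\<bar>) \<le> 4 * e * N"
    by (simp add: mult_ac)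
  have "real (card (Y - G)) \<le> 4 * e * card Y"
    unfolding mult.assoc using card_bad mult_pos_pos[OF \<open>0 < e\<close> cY] by linarith
  then show "\<exists>G\<subseteq>points n. real (card (points n - G)) \<le> 4 * e * real (card (points n)) \<and>
      (\<Sum>y\<in>G. \<bar>\<Sum>i\<in>block n. walsh (A i) y * blinfun_apply (a i) (blinfun_apply (block_op S) (b y))\<bar>)
        \<le> 4 * e * real (card (block n))"
    using sum_le GY unfolding V_def Y_def I_def K_def N_def by blast
qed

definition cylinder :: "nat \<Rightarrow> nat set \<Rightarrow> real linfty" where
  "cylinder n y = Bcontfun (\<lambda>t. of_bool (set_decode t \<inter> {..<\<l> n} = y))"

lemma apply_cylinder: "apply_bcontfun (cylinder n y) t = of_bool (set_decode t \<inter> {..<\<l> n} = y)"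
  by (simp add: cylinder_def apply_Bcontfun_bounded[of _ 1])

lemma sign_bounded_cylinder: "sign_bounded (points n) (cylinder n)"
  unfolding sign_bounded_def
proof (intro allI impI norm_bound)
  fix s :: "nat set \<Rightarrow> real" and t
  assume s: "\<forall>y\<in>points n. \<bar>s y\<bar> \<le> 1"
  have "apply_bcontfun (\<Sum>y\<in>P. s y *\<^sub>R cylinder n y) t
      = (\<Sum>y\<in>P. s y * of_bool (set_decode t \<inter> {..<\<l> n} = y))"
    if "finite P" for P
    using that by (induction P rule: finite_induct) (auto simp: apply_cylinder)
  then have "apply_bcontfun (\<Sum>y\<in>points n. s y *\<^sub>R cylinder n y) t
      = (\<Sum>y\<in>points n. if y = set_decode t \<inter> {..<\<l> n} then s y else 0)"
    by (auto intro!: sum.cong)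
  also have "\<dots> = s (set_decode t \<inter> {..<\<l> n})"
    by (subst sum.delta) (auto simp: points_def)
  finally show "norm (apply_bcontfun (\<Sum>y\<in>points n. s y *\<^sub>R cylinder n y) t) \<le> 1"
    using s by (simp add: points_def)
qed

lemma walsh_coeff_cylinder:
  assumes "y \<in> points n" "i \<in> block n"
  shows "walsh_coeff (A i) (cylinder n y) = walsh (A i) y / 2 ^ \<l> n"
proof -
  have "walsh_coeff (A i) (cylinder n y)
      = mean (\<lambda>T. walsh (A i) y * of_bool (T \<inter> {..<\<l> n} = y))"
  proof -
    have eq: "on_sets (cylinder n y) T * walsh (A i) T = walsh (A i) y * of_bool (T \<inter> {..<\<l> n} = y)"
      if "finite T" for T
    proof -
      have "A i \<inter> T = A i \<inter> (T \<inter> {..<\<l> n})" using A_sub[of n i] assms(2) by (auto simp: block_def)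
      then have "walsh (A i) T = walsh (A i) (T \<inter> {..<\<l> n})" by (simp add: walsh_def)
      then show ?thesis using that by (auto simp: on_sets_def apply_cylinder)
    qed
    have bd: "bdd (\<lambda>T. walsh (A i) y * of_bool (T \<inter> {..<\<l> n} = y))"
      by (rule bddI[of _ 1]) (simp add: abs_mult)
    show ?thesis unfolding walsh_coeff_def
      by (intro antisym mean_mono) (use bd eq in auto)
  qed
  also have "\<dots> = walsh (A i) y * mean (\<lambda>T. of_bool (T \<inter> {..<\<l> n} = y))"
    by (rule mean_cmult) (rule bddI[of _ 1], simp)
  also have "mean (\<lambda>T. of_bool (T \<inter> {..<\<l> n} = y)) = 1 / 2 ^ \<l> n"
    using assms(1) by (intro mean_cylinder) (simp add: points_def)
  finally show ?thesis by simp
qed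

definition coordinate :: "nat \<Rightarrow> real linfty \<Rightarrow>\<^sub>L real" where
  "coordinate k = Blinfun (\<lambda>x. apply_bcontfun x k)"

lemma apply_coordinate [simp]: "blinfun_apply (coordinate k) x = apply_bcontfun x k"
  and norm_coordinate: "norm (coordinate k) \<le> 1"
proof -
  have "bounded_linear (\<lambda>x :: real linfty. apply_bcontfun x k)"
    by (rule bounded_linear_intro[where K = 1])
      (simp_all add: norm_bounded[where 'b = real, unfolded real_norm_def])
  then show *: "blinfun_apply (coordinate k) x = apply_bcontfun x k" for x
    by (simp add: coordinate_def bounded_linear_Blinfun_apply)
  show "norm (coordinate k) \<le> 1"
    by (rule norm_blinfun_bound) (simp_all add: * norm_bounded[where 'b = real, unfolded real_norm_def])
qed

text \<open>
  The indicators of the cylinders over the points of block \<open>n\<close>, read off by the coordinates of that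
  block, reproduce its matrix up to the factor \<open>1 / M\<close>, with \<open>M\<close> the number of points. Every point then
  contributes the same amount \<open>N / M\<close>, so discarding a few points cannot make the sum small.
\<close>

lemma not_small_block_op:
  assumes "n \<in> S" "small n e (block_op S)"
  shows "1 / 2 \<le> e"
proof -
  define M N where "M = real (card (points n))" and "N = real (card (block n))"
  have pos: "0 < M" "0 < N" using card_block_pos by (simp_all add: M_def N_def card_points)
  obtain G where G: "G \<subseteq> points n" "real (card (points n - G)) \<le> e * M"
    "(\<Sum>y\<in>G. \<bar>\<Sum>i\<in>block n. walsh (A i) y * blinfun_apply (coordinate i)
        (blinfun_apply (block_op S) (cylinder n y))\<bar>) \<le> e * N"
    using diagonal_smallD[OF assms(2) sign_bounded_cylinder, of coordinate] norm_coordinate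
    unfolding M_def N_def by blast
  have "\<bar>\<Sum>i\<in>block n. walsh (A i) y * blinfun_apply (coordinate i)
        (blinfun_apply (block_op S) (cylinder n y))\<bar> = N / M" if "y \<in> G" for y
  proof -
    have "(\<Sum>i\<in>block n. walsh (A i) y * blinfun_apply (coordinate i)
        (blinfun_apply (block_op S) (cylinder n y))) = (\<Sum>i\<in>block n. 1 / M)"
      using that G(1) assms(1)
      by (intro sum.cong refl) (auto simp: apply_coeff_op walsh_coeff_cylinder M_def card_points)
    then show ?thesis using pos by (simp add: N_def)
  qed
  then have "card G * (N / M) \<le> e * N" using G(3) by simp
  then have "card G \<le> e * M" using pos by (simp add: field_simps)
  moreover have "M = card G + card (points n - G)"
    unfolding M_def using G(1) by (metis card_Diff_subset card_mono finite_points finite_subset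
        le_add_diff_inverse of_nat_add)
  ultimately have "M \<le> 2 * e * M" using G(2) by simp
  then show ?thesis using pos by simp
qed

end

section \<open>Existence of independent blocks\<close>

text \<open>
  Block \<open>n\<close> gets degree of independence \<open>d n = 4 ^ n\<close> and ends at a power \<open>K\<close> of two. The
  greedy choice then needs only \<open>2 * K ^ d n\<close> points, so \<open>s n = 2 * d n\<close> makes them few compared with
  \<open>N ^ s n\<close>, and \<open>2 * s n = d (n + 1)\<close> is the independence provided by the next block. Each \<open>K\<close> is taken
  large in terms of \<open>n\<close> and of the previous one, which gives the growth conditions.
\<close>

lemma ex_independent_blocks: "\<exists>A \<kappa> \<l> s. independent_blocks A \<kappa> \<l> s"
proof -
  define d s :: "nat \<Rightarrow> nat" where "d = (\<lambda>n. 4 ^ n)" and "s = (\<lambda>n. 2 * d n)"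
  have d_pos: "1 \<le> d n" for n by (simp add: d_def)
  have d_mono: "m \<le> n \<Longrightarrow> d m \<le> d n" for m n by (simp add: d_def)
  obtain e :: "nat \<Rightarrow> nat" where e: "\<And>n. 2 * real (n + 1) * (2 ^ e n) ^ 2 \<le> 2 ^ e (Suc n)"
    "\<And>n. 2 * moment_const (s n) * (2 * real (n + 1)) ^ s n \<le> 2 ^ e (Suc n)"
  proof -
    have "\<exists>e :: nat \<Rightarrow> nat. \<forall>n. True \<and> (2 * real (n + 1) * (2 ^ e n) ^ 2 \<le> 2 ^ e (Suc n) \<and>
        2 * moment_const (s n) * (2 * real (n + 1)) ^ s n \<le> 2 ^ e (Suc n))"
    proof (rule dependent_nat_choice)
      fix x n :: nat
      let ?u = "2 * real (n + 1) * (2 ^ x) ^ 2" and ?v = "2 * moment_const (s n) * (2 * real (n + 1)) ^ s n"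
      obtain y where "max ?u ?v < 2 ^ y" using real_arch_pow[of 2 "max ?u ?v"] by auto
      then show "\<exists>y. True \<and> (?u \<le> 2 ^ y \<and> ?v \<le> 2 ^ y)" by (auto intro: less_imp_le)
    qed simp
    then show ?thesis using that by blast
  qed
  define \<kappa> where "\<kappa> = (\<lambda>n. 2 ^ e n :: nat)"
  define \<l> where "\<l> = (\<lambda>n. e (Suc n) * d n + 1)"
  have \<kappa>1: "1 \<le> \<kappa> n" for n by (simp add: \<kappa>_def)
  have grow: "2 * ((n + 1) * \<kappa> n ^ 2) \<le> \<kappa> (Suc n)" for n
  proof -
    have "real (2 * ((n + 1) * \<kappa> n ^ 2)) \<le> real (\<kappa> (Suc n))"
      using e(1)[of n] by (simp add: \<kappa>_def algebra_simps)
    then show ?thesis unfolding of_nat_le_iff .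
  qed
  have sq: "\<kappa> n \<le> (n + 1) * \<kappa> n ^ 2" for n
    using mult_le_mono[of 1 "n + 1" "\<kappa> n" "\<kappa> n ^ 2"] \<kappa>1[of n] by (simp add: power2_eq_square)
  have less: "\<kappa> n < \<kappa> (Suc n)" for n using grow[of n] sq[of n] \<kappa>1[of n] by linarith
  have mono: "m \<le> n \<Longrightarrow> \<kappa> m \<le> \<kappa> n" for m n
    by (rule lift_Suc_mono_le[of \<kappa>]) (simp_all add: less less_imp_le)
  \<comment> \<open>\<open>nb k\<close> is the number of the block that contains \<open>k\<close>; the indices below \<open>\<kappa> 0\<close> join block \<open>0\<close>.\<close>
  define nb where "nb = (\<lambda>k. LEAST n. k < \<kappa> (Suc n))"
  have nb: "k < \<kappa> (Suc (nb k))" for k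
  proof -
    have "n \<le> \<kappa> n" for n
    proof (induction n)
      case (Suc n) then show ?case using less[of n] by linarith
    qed simp
    then have "k < \<kappa> (Suc k)" using less_le_trans[of k "Suc k"] by blast
    then show ?thesis unfolding nb_def by (rule LeastI)
  qed
  have nb_ge: "n \<le> nb k" if "\<kappa> n \<le> k" for n k
  proof (rule ccontr)
    assume "\<not> n \<le> nb k"
    then have "\<kappa> (Suc (nb k)) \<le> \<kappa> n" by (intro mono) simp
    with nb[of k] that show False by linarith
  qed
  have "(k + 1) ^ d (nb k) < 2 ^ \<l> (nb k)" for k
  proof -
    have "(k + 1) ^ d (nb k) \<le> \<kappa> (Suc (nb k)) ^ d (nb k)" using nb[of k] by (intro power_mono) auto
    also have "\<dots> < 2 ^ \<l> (nb k)" by (simp add: \<kappa>_def \<l>_def flip: power_mult)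
    finally show ?thesis .
  qed
  then obtain A :: "nat \<Rightarrow> nat set" where A: "\<And>k. A k \<subseteq> {..<\<l> (nb k)}"
      "\<And>k. A k \<notin> combos (A ` {..<k}) (d (nb k))"
    using greedy_independent_sets[of "\<lambda>k. d (nb k)" "\<lambda>k. \<l> (nb k)"] by blast
  have indep: "A k \<notin> combos (A ` {..<k}) a" if "a \<le> d (nb k)" for k a
    using A(2)[of k] combos_mono[OF order_refl that] by blast
  have "independent_blocks A \<kappa> \<l> s"
  proof
    show "finite (A k)" for k using A(1) finite_subset by blast
    show "\<kappa> n < \<kappa> (Suc n)" for n by (rule less)
    show "A k \<subseteq> {..<\<l> n}" if "\<kappa> n \<le> k" "k < \<kappa> (Suc n)" for n k
    proof -
      have "nb k \<le> n" unfolding nb_def using that(2) by (rule Least_le)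
      then have "nb k = n" using nb_ge[OF that(1)] by simp
      then show ?thesis using A(1)[of k] by simp
    qed
    show "A k \<notin> combos (A ` {..<k}) 1" for k by (rule indep) (rule d_pos)
    show "A k \<notin> combos (A ` {..<k}) (2 * s n - 1)" if "\<kappa> (Suc n) \<le> k" for n k
    proof (rule indep)
      have "2 * s n - 1 \<le> d (Suc n)" by (simp add: s_def d_def)
      also have "\<dots> \<le> d (nb k)" by (intro d_mono nb_ge that)
      finally show "2 * s n - 1 \<le> d (nb k)" .
    qed
    show "1 \<le> s n" for n using d_pos[of n] by (simp add: s_def)
    show "(n + 1) * \<kappa> n ^ 2 \<le> \<kappa> (Suc n) - \<kappa> n" for n using grow[of n] sq[of n] by linarith
    show "2 ^ \<l> n * moment_const (s n) * real (n + 1) ^ s n \<le> real (\<kappa> (Suc n) - \<kappa> n) ^ s n" for n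
    proof -
      define K where "K = real (\<kappa> (Suc n))"
      have K: "1 \<le> K" using \<kappa>1[of "Suc n"] by (simp add: K_def)
      have half: "K \<le> 2 * real (\<kappa> (Suc n) - \<kappa> n)"
        using grow[of n] sq[of n] by (simp add: K_def of_nat_diff)
      have "2 ^ \<l> n = 2 * K ^ d n" by (simp add: \<l>_def K_def \<kappa>_def power_mult)
      then have "2 ^ s n * (2 ^ \<l> n * moment_const (s n) * real (n + 1) ^ s n)
          = K ^ d n * (2 * moment_const (s n) * (2 * real (n + 1)) ^ s n)"
        by (simp only: power_mult_distrib mult_ac)
      also have "\<dots> \<le> K ^ d n * K"
        using e(2)[of n] K by (intro mult_left_mono) (simp_all add: K_def \<kappa>_def)
      also have "\<dots> \<le> K ^ d n * K ^ d n"
        using K power_increasing[of 1 "d n" K] d_pos[of n] by (intro mult_left_mono) auto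
      also have "\<dots> = K ^ s n" by (simp add: s_def mult_2 power_add)
      also have "\<dots> \<le> (2 * real (\<kappa> (Suc n) - \<kappa> n)) ^ s n" using half K by (intro power_mono) auto
      also have "\<dots> = 2 ^ s n * real (\<kappa> (Suc n) - \<kappa> n) ^ s n" by (rule power_mult_distrib)
      finally show ?thesis by simp
    qed
  qed
  then show ?thesis by blast
qed

section \<open>Extension to the scalar field\<close>

definition pointwise ::
    "('a::real_normed_vector \<Rightarrow>\<^sub>L 'b::real_normed_vector) \<Rightarrow> (nat \<Rightarrow>\<^sub>C 'a) \<Rightarrow>\<^sub>L (nat \<Rightarrow>\<^sub>C 'b)" where
  "pointwise f = Blinfun (\<lambda>x. Bcontfun (\<lambda>n. blinfun_apply f (apply_bcontfun x n)))"

lemma apply_pointwise [simp]: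
  fixes f :: "'a::real_normed_vector \<Rightarrow>\<^sub>L 'b::real_normed_vector"
  shows "apply_bcontfun (blinfun_apply (pointwise f) x) n = blinfun_apply f (apply_bcontfun x n)"
  and norm_pointwise: "norm (pointwise f) \<le> norm f"
proof -
  have le: "norm (blinfun_apply f (apply_bcontfun x n)) \<le> norm x * norm f" for x n
    using order_trans[OF norm_blinfun mult_left_mono[OF norm_bounded[of x n] norm_ge_zero[of f]]]
    by (simp add: mult.commute)
  define g where "g = (\<lambda>x :: nat \<Rightarrow>\<^sub>C 'a. Bcontfun (\<lambda>n. blinfun_apply f (apply_bcontfun x n)))"
  have *: "apply_bcontfun (g x) n = blinfun_apply f (apply_bcontfun x n)" for x n
    unfolding g_def by (rule fun_cong, rule apply_Bcontfun_bounded[of _ "norm x * norm f"]) (rule le)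
  have "bounded_linear g"
    by (rule bounded_linear_intro[where K = "norm f"])
      (auto intro!: bcontfun_eqI norm_bound simp: * blinfun.add_right blinfun.scaleR_right le)
  then show **: "apply_bcontfun (blinfun_apply (pointwise f) x) n
      = blinfun_apply f (apply_bcontfun x n)" for x n
    unfolding pointwise_def g_def[symmetric] by (simp add: bounded_linear_Blinfun_apply *)
  show "norm (pointwise f) \<le> norm f"
    by (rule norm_blinfun_bound) (auto intro!: norm_bound simp: ** le mult.commute[of "norm f"])
qed

text \<open>
  For complex scalars this is the complexification of \<open>V\<close>. Writing it through a real basis of the
  field treats real and complex scalars alike.
\<close>

definition extend_scalars ::
    "real linfty_op \<Rightarrow> 'k::{real_normed_field,euclidean_space} linfty_op" where
  "extend_scalars V =
     (\<Sum>\<beta>\<in>Basis. pointwise (blinfun_scaleR_left \<beta>) o\<^sub>L V o\<^sub>L pointwise (blinfun_inner_left \<beta>))"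

lemma apply_extend_scalars:
  "apply_bcontfun (blinfun_apply (extend_scalars V) x) n =
    (\<Sum>\<beta>\<in>Basis. apply_bcontfun (blinfun_apply V (blinfun_apply (pointwise (blinfun_inner_left \<beta>)) x)) n *\<^sub>R \<beta>)"
proof -
  have "apply_bcontfun (blinfun_apply (\<Sum>\<beta>\<in>B. pointwise (blinfun_scaleR_left \<beta>) o\<^sub>L V o\<^sub>L pointwise (blinfun_inner_left \<beta>)) x) n
    = (\<Sum>\<beta>\<in>B. apply_bcontfun (blinfun_apply V (blinfun_apply (pointwise (blinfun_inner_left \<beta>)) x)) n *\<^sub>R \<beta>)" for B
    by (induction B rule: infinite_finite_induct) (simp_all add: blinfun.add_left blinfun.zero_left)
  then show ?thesis by (simp add: extend_scalars_def)
qed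

text \<open>
  \<open>V\<close> acts on the real components, so \<open>extend_scalars V\<close> commutes with every real-linear map of the field
  that is applied pointwise, in particular with multiplication by \<open>c\<close>.
\<close>

lemma extend_scalars_in_carrier:
  "(extend_scalars V :: 'k::{real_normed_field,euclidean_space} linfty_op) \<in> L_linfty_carrier"
  unfolding L_linfty_carrier_def
proof (intro CollectI allI bcontfun_eqI)
  fix c :: 'k and x :: "'k linfty" and n
  let ?\<pi> = "\<lambda>\<beta> x. blinfun_apply (pointwise (blinfun_inner_left \<beta>)) x"
  let ?v = "\<lambda>\<gamma>. apply_bcontfun (blinfun_apply V (?\<pi> \<gamma> x)) n"
  have lin: "?\<pi> \<beta> (scale_linfty c x) = (\<Sum>\<gamma>\<in>Basis. ((c * \<gamma>) \<bullet> \<beta>) *\<^sub>R ?\<pi> \<gamma> x)" for \<beta>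
  proof (rule bcontfun_eqI)
    fix m
    have sum: "apply_bcontfun (\<Sum>\<gamma>\<in>B. ((c * \<gamma>) \<bullet> \<beta>) *\<^sub>R ?\<pi> \<gamma> x) m
        = (\<Sum>\<gamma>\<in>B. (apply_bcontfun x m \<bullet> \<gamma>) * ((c * \<gamma>) \<bullet> \<beta>))" for B
      by (induction B rule: infinite_finite_induct) (simp_all add: mult.commute)
    have "c * apply_bcontfun x m = c * (\<Sum>\<gamma>\<in>Basis. (apply_bcontfun x m \<bullet> \<gamma>) *\<^sub>R \<gamma>)"
      by (simp add: euclidean_representation)
    also have "\<dots> = (\<Sum>\<gamma>\<in>Basis. (apply_bcontfun x m \<bullet> \<gamma>) *\<^sub>R (c * \<gamma>))"
      by (simp add: sum_distrib_left)
    finally show "apply_bcontfun (?\<pi> \<beta> (scale_linfty c x)) m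
        = apply_bcontfun (\<Sum>\<gamma>\<in>Basis. ((c * \<gamma>) \<bullet> \<beta>) *\<^sub>R ?\<pi> \<gamma> x) m"
      by (simp add: sum inner_sum_left)
  qed
  have V: "apply_bcontfun (blinfun_apply V (\<Sum>\<gamma>\<in>B. r \<gamma> *\<^sub>R ?\<pi> \<gamma> x)) n = (\<Sum>\<gamma>\<in>B. r \<gamma> * ?v \<gamma>)" for r B
    by (induction B rule: infinite_finite_induct) (simp_all add: blinfun.add_right blinfun.scaleR_right blinfun.zero_right)
  have "apply_bcontfun (blinfun_apply (extend_scalars V) (scale_linfty c x)) n
      = (\<Sum>\<beta>\<in>Basis. (\<Sum>\<gamma>\<in>Basis. ((c * \<gamma>) \<bullet> \<beta>) * ?v \<gamma>) *\<^sub>R \<beta>)"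
    unfolding apply_extend_scalars lin V ..
  also have "\<dots> = (\<Sum>\<gamma>\<in>Basis. ?v \<gamma> *\<^sub>R (\<Sum>\<beta>\<in>Basis. ((c * \<gamma>) \<bullet> \<beta>) *\<^sub>R \<beta>))"
    unfolding scaleR_sum_left scaleR_sum_right by (subst sum.swap) (simp add: mult.commute)
  also have "\<dots> = (\<Sum>\<gamma>\<in>Basis. ?v \<gamma> *\<^sub>R (c * \<gamma>))" by (simp only: euclidean_representation)
  also have "\<dots> = c * (\<Sum>\<gamma>\<in>Basis. ?v \<gamma> *\<^sub>R \<gamma>)" by (simp add: sum_distrib_left)
  finally show "apply_bcontfun (blinfun_apply (extend_scalars V) (scale_linfty c x)) n
      = apply_bcontfun (scale_linfty c (blinfun_apply (extend_scalars V) x)) n"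
    by (simp add: apply_extend_scalars)
qed

lemma diagonal_small_extend_scalars:
  assumes "finite Y" "diagonal_small Y I u e V" "0 \<le> e"
  shows "diagonal_small Y I u (real DIM('k) * e)
    (extend_scalars V :: 'k::{real_normed_field,euclidean_space} linfty_op)"
proof -
  let ?T = "\<lambda>\<beta>::'k. pointwise (blinfun_scaleR_left \<beta>) o\<^sub>L V o\<^sub>L pointwise (blinfun_inner_left \<beta>)"
  have one: "diagonal_small Y I u e (?T \<beta>)" if "\<beta> \<in> Basis" for \<beta> :: 'k
  proof -
    have "norm (blinfun_scaleR_left \<beta>) \<le> 1" "norm (blinfun_inner_left \<beta>) \<le> 1"
      using that by (auto intro!: norm_blinfun_bound Basis_le_norm)
    then have "norm (pointwise (blinfun_scaleR_left \<beta>))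
        \<le> 1" "norm (pointwise (blinfun_inner_left \<beta>)) \<le> 1"
      using norm_pointwise order_trans by blast+
    then have "norm (pointwise (blinfun_scaleR_left \<beta>)) * norm (pointwise (blinfun_inner_left \<beta>))
        \<le> 1"
      by (simp add: mult_le_one)
    then show ?thesis using diagonal_small_compose[OF assms(2) _ order_refl assms(3)] by simp
  qed
  have "diagonal_small Y I u (real (card B) * e) (\<Sum>\<beta>\<in>B. ?T \<beta>)" if "finite B" "B \<subseteq> Basis" for B
    using that
  proof (induction B rule: finite_induct)
    case empty
    show ?case unfolding diagonal_small_def
      by (auto intro!: exI[of _ Y] simp: blinfun.zero_left blinfun.zero_right)
  next
    case (insert \<beta> B)
    then have "diagonal_small Y I u (e + real (card B) * e) (?T \<beta> + (\<Sum>\<beta>\<in>B. ?T \<beta>))"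
      by (intro diagonal_small_add assms(1) one) auto
    with insert show ?case by (simp add: algebra_simps)
  qed
  from this[of Basis] show ?thesis by (simp add: extend_scalars_def)
qed

text \<open>
  \<open>V\<close> is recovered from its extension by restricting to real multiples of \<open>1\<close> and taking the
  component along \<open>1\<close>, two contractions.
\<close>

lemma diagonal_small_if_extend_scalars:
  assumes "diagonal_small Y I u e (extend_scalars V :: 'k::{real_normed_field,euclidean_space} linfty_op)"
    and "0 \<le> e"
  shows "diagonal_small Y I u e V"
proof -
  let ?R = "pointwise (blinfun_inner_left (1::'k))" and ?Q = "pointwise (blinfun_scaleR_left (1::'k))"
  have "norm (blinfun_scaleR_left (1::'k)) \<le> 1" "norm (blinfun_inner_left (1::'k)) \<le> 1"
    using Cauchy_Schwarz_ineq2[of _ "1::'k"] by (auto intro!: norm_blinfun_bound)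
  then have "norm ?R \<le> 1" "norm ?Q \<le> 1" using norm_pointwise order_trans by blast+
  then have RQ: "norm ?R * norm ?Q \<le> 1" by (simp add: mult_le_one)
  have "?R o\<^sub>L extend_scalars V o\<^sub>L ?Q = V"
  proof (intro blinfun_eqI bcontfun_eqI)
    fix x n
    have *: "blinfun_apply (pointwise (blinfun_inner_left \<beta>)) (blinfun_apply ?Q x)
        = (1 \<bullet> \<beta>) *\<^sub>R x" for \<beta> :: 'k
      by (rule bcontfun_eqI) simp
    have "apply_bcontfun (blinfun_apply (extend_scalars V) (blinfun_apply ?Q x)) n
        = (\<Sum>\<beta>\<in>Basis. ((1::'k) \<bullet> \<beta> * apply_bcontfun (blinfun_apply V x) n) *\<^sub>R \<beta>)"
      by (simp add: apply_extend_scalars * blinfun.scaleR_right)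
    also have "\<dots> = apply_bcontfun (blinfun_apply V x) n *\<^sub>R (\<Sum>\<beta>\<in>Basis. ((1::'k) \<bullet> \<beta>) *\<^sub>R \<beta>)"
      by (simp add: scaleR_sum_right mult.commute)
    also have "\<dots> = apply_bcontfun (blinfun_apply V x) n *\<^sub>R 1"
      by (simp only: euclidean_representation)
    finally show "apply_bcontfun (blinfun_apply (?R o\<^sub>L extend_scalars V o\<^sub>L ?Q) x) n
        = apply_bcontfun (blinfun_apply V x) n"
      by (simp add: dot_square_norm)
  qed
  then show ?thesis using diagonal_small_compose[OF assms(1) RQ order_refl assms(2)] by simp
qed

section \<open>Closed ideals\<close>

context independent_blocks
begin

text \<open>
  The ideal of the operators that asymptotically reproduce no blocks except those with number in \<open>S\<close>.
\<close>

definition block_ideal :: "nat set \<Rightarrow> 'k::real_normed_field linfty_op set" where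
  "block_ideal S = {T \<in> L_linfty_carrier.
     \<forall>e>0. \<forall>\<^sub>F n in sequentially. n \<notin> S \<longrightarrow> small n e T}"

lemma block_ideal_compose:
  assumes "T \<in> block_ideal S" "R o\<^sub>L T o\<^sub>L Q \<in> L_linfty_carrier"
  shows "R o\<^sub>L T o\<^sub>L Q \<in> block_ideal S"
  unfolding block_ideal_def
proof (intro CollectI conjI allI impI assms(2))
  fix e :: real assume "0 < e"
  define C where "C = max 1 (norm R * norm Q)"
  have C: "1 \<le> C" "norm R * norm Q \<le> C" by (auto simp: C_def)
  with \<open>0 < e\<close> have "0 < e / C" by simp
  then have "\<forall>\<^sub>F n in sequentially. n \<notin> S \<longrightarrow> small n (e / C) T"
    using assms(1) unfolding block_ideal_def by blast
  then show "\<forall>\<^sub>F n in sequentially. n \<notin> S \<longrightarrow> small n e (R o\<^sub>L T o\<^sub>L Q)"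
  proof (rule eventually_mono, intro impI)
    fix n assume "n \<notin> S \<longrightarrow> small n (e / C) T" "n \<notin> S"
    then have "small n (C * (e / C)) (R o\<^sub>L T o\<^sub>L Q)"
      using C \<open>0 < e / C\<close> by (intro diagonal_small_compose) auto
    then show "small n e (R o\<^sub>L T o\<^sub>L Q)" using C by simp
  qed
qed

lemma block_ideal_add:
  assumes "T \<in> block_ideal S" "T' \<in> block_ideal S"
  shows "T + T' \<in> block_ideal S"
  unfolding block_ideal_def
proof (intro CollectI conjI allI impI)
  show "T + T' \<in> L_linfty_carrier"
    using assms by (auto simp: block_ideal_def L_linfty_carrier_def blinfun.add_left scale_linfty_add)
  fix e :: real assume "0 < e"
  then have "\<forall>\<^sub>F n in sequentially. n \<notin> S \<longrightarrow> small n (e / 2) T"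
    "\<forall>\<^sub>F n in sequentially. n \<notin> S \<longrightarrow> small n (e / 2) T'"
    using assms unfolding block_ideal_def by (auto dest!: spec[of _ "e / 2"])
  then show "\<forall>\<^sub>F n in sequentially. n \<notin> S \<longrightarrow> small n e (T + T')"
  proof eventually_elim
    case (elim n)
    then show ?case using diagonal_small_add[of "points n" "block n" _ "e / 2" T "e / 2" T'] by simp
  qed
qed

lemma ideal_block_ideal: "ideal (block_ideal S) (L_linfty :: 'k::real_normed_field linfty_op ring)"
proof (rule idealI[OF ring_L_linfty])
  interpret ring "L_linfty :: 'k linfty_op ring" by (rule ring_L_linfty)
  show "subgroup (block_ideal S) (add_monoid (L_linfty :: 'k linfty_op ring))"
  proof (rule add.subgroupI)
    show "block_ideal S \<subseteq> carrier (L_linfty :: 'k linfty_op ring)"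
      by (auto simp: block_ideal_def L_linfty_def)
    have "(0 :: 'k linfty_op) \<in> block_ideal S"
      by (auto simp: block_ideal_def L_linfty_carrier_def blinfun.zero_left scale_linfty_zero
          diagonal_small_norm intro!: always_eventually)
    then show "(block_ideal S :: 'k linfty_op set) \<noteq> {}" by auto
    fix T :: "'k linfty_op" assume T: "T \<in> block_ideal S"
    then have carr: "T \<in> L_linfty_carrier" by (simp add: block_ideal_def)
    have eq: "- T = (- id_blinfun) o\<^sub>L T o\<^sub>L id_blinfun"
      by (rule blinfun_eqI) (simp add: blinfun.minus_left)
    have mcarr: "- T \<in> L_linfty_carrier"
      using carr by (auto simp: L_linfty_carrier_def blinfun.minus_left scale_linfty_minus)
    have "\<ominus>\<^bsub>L_linfty\<^esub> T = - T"
      by (rule minus_equality) (use carr mcarr in \<open>simp_all add: L_linfty_def\<close>)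
    moreover have "- T \<in> block_ideal S"
      using block_ideal_compose[OF T, of "- id_blinfun" id_blinfun] mcarr unfolding eq by simp
    ultimately show "\<ominus>\<^bsub>L_linfty\<^esub> T \<in> block_ideal S" by simp
  next
    fix T T' :: "'k linfty_op" assume "T \<in> block_ideal S" "T' \<in> block_ideal S"
    then show "T \<oplus>\<^bsub>L_linfty\<^esub> T' \<in> block_ideal S" using block_ideal_add by (simp add: L_linfty_def)
  qed
next
  fix T R :: "'k linfty_op" assume T: "T \<in> block_ideal S" and R: "R \<in> carrier L_linfty"
  then have carr: "T \<in> L_linfty_carrier" "R \<in> L_linfty_carrier"
    by (simp_all add: block_ideal_def L_linfty_def)
  have eq: "R o\<^sub>L T o\<^sub>L id_blinfun = R o\<^sub>L T" "id_blinfun o\<^sub>L T o\<^sub>L R = T o\<^sub>L R"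
    by (auto intro: blinfun_eqI)
  have "R o\<^sub>L T \<in> L_linfty_carrier" "T o\<^sub>L R \<in> L_linfty_carrier"
    using carr by (auto simp: L_linfty_carrier_def)
  then show "R \<otimes>\<^bsub>L_linfty\<^esub> T \<in> block_ideal S" "T \<otimes>\<^bsub>L_linfty\<^esub> R \<in> block_ideal S"
    using block_ideal_compose[OF T, of R id_blinfun] block_ideal_compose[OF T, of id_blinfun R]
    unfolding eq by (simp_all add: L_linfty_def)
qed

lemma closed_block_ideal: "closed (block_ideal S :: 'k::real_normed_field linfty_op set)"
  unfolding closed_sequential_limits
proof (intro allI impI, elim conjE)
  fix T :: "nat \<Rightarrow> 'k linfty_op" and U
  assume T: "\<forall>j. T j \<in> block_ideal S" and lim: "T \<longlonglongrightarrow> U"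
  show "U \<in> block_ideal S"
    unfolding block_ideal_def
  proof (intro CollectI conjI allI impI)
    show "U \<in> L_linfty_carrier"
      unfolding L_linfty_carrier_def
    proof (intro CollectI allI)
      fix c :: 'k and x
      have "(\<lambda>j. blinfun_apply (T j) (scale_linfty c x)) \<longlonglongrightarrow> blinfun_apply U (scale_linfty c x)"
        by (intro tendsto_intros lim)
      moreover have "(\<lambda>j. blinfun_apply (scale_op c) (blinfun_apply (T j) x)) \<longlonglongrightarrow> blinfun_apply (scale_op c) (blinfun_apply U x)"
        by (intro tendsto_intros lim)
      moreover have "blinfun_apply (T j) (scale_linfty c x)
          = blinfun_apply (scale_op c) (blinfun_apply (T j) x)" for j
        using T by (simp add: block_ideal_def L_linfty_carrier_def)
      ultimately show "blinfun_apply U (scale_linfty c x) = scale_linfty c (blinfun_apply U x)"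
        using LIMSEQ_unique by simp
    qed
    fix e :: real assume "0 < e"
    then obtain j where j: "norm (U - T j) \<le> e / 2"
      using LIMSEQ_D[OF lim, of "e / 2"]
        by (metis half_gt_zero less_imp_le norm_minus_commute order_refl)
    have "\<forall>\<^sub>F n in sequentially. n \<notin> S \<longrightarrow> small n (e / 2) (T j)"
      using T \<open>0 < e\<close> unfolding block_ideal_def by (auto dest!: spec[of _ "e / 2"])
    then show "\<forall>\<^sub>F n in sequentially. n \<notin> S \<longrightarrow> small n e U"
    proof (rule eventually_mono, intro impI)
      fix n assume "n \<notin> S \<longrightarrow> small n (e / 2) (T j)" "n \<notin> S"
      moreover have "small n (e / 2) (U - T j)" using j by (intro diagonal_small_norm) simp_all
      ultimately show "small n e U"
        using diagonal_small_add[of "points n" "block n" _ "e / 2" "U - T j" "e / 2" "T j"] by simp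
    qed
  qed
qed

lemma extend_block_op_in_block_ideal:
  "(extend_scalars (block_op S) :: 'k::{real_normed_field,euclidean_space} linfty_op) \<in> block_ideal S"
  unfolding block_ideal_def
proof (intro CollectI conjI allI impI extend_scalars_in_carrier)
  fix e :: real assume "0 < e"
  define e' where "e' = e / (4 * real DIM('k))"
  have e': "0 < e'" "real DIM('k) * (4 * e') = e" using \<open>0 < e\<close> by (simp_all add: e'_def)
  have "(\<lambda>n. 1 / real (n + 1)) \<longlonglongrightarrow> 0"
    using LIMSEQ_inverse_real_of_nat by (simp add: inverse_eq_divide add.commute)
  then have "\<forall>\<^sub>F n in sequentially. 1 / real (n + 1) < e' ^ 3"
    using e' by (intro order_tendstoD) auto
  then show "\<forall>\<^sub>F n in sequentially. n \<notin> S \<longrightarrow> small n e (extend_scalars (block_op S) :: 'k linfty_op)"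
  proof (rule eventually_mono, intro impI)
    fix n assume "1 / real (n + 1) < e' ^ 3" "n \<notin> S"
    then have "small n (4 * e') (block_op S)" using e' by (intro small_block_op) auto
    then show "small n e (extend_scalars (block_op S) :: 'k linfty_op)"
      using diagonal_small_extend_scalars[of "points n" "block n" _ "4 * e'" "block_op S", where 'k = 'k] e' by simp
  qed
qed

lemma extend_block_op_notin_block_ideal:
  assumes "infinite (S - S')"
  shows "(extend_scalars (block_op S) :: 'k::{real_normed_field,euclidean_space} linfty_op) \<notin> block_ideal S'"
proof
  assume "(extend_scalars (block_op S) :: 'k linfty_op) \<in> block_ideal S'"
  then have "\<forall>\<^sub>F n in sequentially. n \<notin> S' \<longrightarrow> small n (1 / 4) (extend_scalars (block_op S) :: 'k linfty_op)"
    unfolding block_ideal_def by (auto dest!: spec[of _ "1 / 4"])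
  then obtain m where m: "\<And>n. n \<ge> m \<Longrightarrow> n \<notin> S' \<Longrightarrow> small n (1 / 4) (extend_scalars (block_op S) :: 'k linfty_op)"
    by (auto simp: eventually_sequentially)
  obtain n where "n \<ge> m" "n \<in> S - S'" using assms by (metis infinite_nat_iff_unbounded_le)
  then have "small n (1 / 4) (block_op S)"
    using m[of n] by (intro diagonal_small_if_extend_scalars[where 'k = 'k]) auto
  then show False using not_small_block_op[of n S "1 / 4"] \<open>n \<in> S - S'\<close> by simp
qed

end

section \<open>A continuum of closed ideals\<close>

text \<open>
  The classical almost disjoint family: the codes of all initial traces of \<open>X\<close>. Two different sets have
  only finitely many initial traces in common.
\<close>

definition initial_traces :: "nat set \<Rightarrow> nat set" where
  "initial_traces X = range (\<lambda>n. prod_encode (n, set_encode (X \<inter> {..<n})))"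

lemma infinite_initial_traces_diff:
  assumes "X \<noteq> Z"
  shows "infinite (initial_traces X - initial_traces Z)"
proof -
  obtain k where k: "k \<in> X \<longleftrightarrow> k \<notin> Z" using assms by blast
  let ?f = "\<lambda>n. prod_encode (n, set_encode (X \<inter> {..<n}))"
  have "?f n \<notin> initial_traces Z" if "k < n" for n
  proof
    assume "?f n \<in> initial_traces Z"
    then have "X \<inter> {..<n} = Z \<inter> {..<n}" by (auto simp: initial_traces_def set_encode_eq)
    then show False using k that by blast
  qed
  then have "?f ` {k<..} \<subseteq> initial_traces X - initial_traces Z" by (auto simp: initial_traces_def)
  moreover have "infinite (?f ` {k<..})"
    by (subst finite_image_iff) (auto simp: inj_on_def infinite_Ioi)
  ultimately show ?thesis using finite_subset by blast
qed

lemma continuum_of_closed_ideals: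
  "\<exists>F :: 'k::{real_normed_field,euclidean_space} linfty_op set set.
     F \<subseteq> closed_ideals \<and> F \<approx> (UNIV :: nat set set)"
proof -
  obtain A \<kappa> \<l> s where "independent_blocks A \<kappa> \<l> s" using ex_independent_blocks by blast
  then interpret independent_blocks A \<kappa> \<l> s .
  let ?J = "\<lambda>X. block_ideal (initial_traces X) :: 'k linfty_op set"
  have "inj ?J"
  proof (rule injI, rule ccontr)
    fix X Z assume "?J X = ?J Z" "X \<noteq> Z"
    then show False
      using extend_block_op_in_block_ideal[of "initial_traces X", where 'k = 'k]
        extend_block_op_notin_block_ideal[OF infinite_initial_traces_diff, of X Z, where 'k = 'k] by simp
  qed
  then have "range ?J \<approx> (UNIV :: nat set set)" by (rule inj_on_image_eqpoll_self)
  moreover have "range ?J \<subseteq> closed_ideals"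
    using ideal_block_ideal closed_block_ideal by (auto simp: closed_ideals_def)
  ultimately show ?thesis by blast
qed

theorem theorem4p2:
  shows "(\<exists>F :: real linfty_op set set. F \<subseteq> closed_ideals \<and> F \<approx> (UNIV :: nat set set)) \<and>
         (\<exists>F :: complex linfty_op set set. F \<subseteq> closed_ideals \<and> F \<approx> (UNIV :: nat set set))"
  by (intro conjI; rule continuum_of_closed_ideals)

end
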